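(* For every real $\varepsilon>0$ and every $n\ge1$, $\varepsilon\text{-}\operatorname{Proj}^-_{\mathbb{R}^n}\equiv_{\mathrm{sW}}\operatorname{C}_\mathbb{R}$.
   Context: Represented spaces: a representation of a set $X$ is a partial surjection $\delta_X:\subseteq\mathbb{N}^\mathbb{N}\to X$. For a partial multi-valued function $f:\subseteq X\rightrightarrows Y$, a realizer is a partial $F:\subseteq\mathbb{N}^\mathbb{N}\to\mathbb{N}^\mathbb{N}$ with $\delta_Y(F(p))\in f(\delta_X(p))$ for all $p$ with $\delta_X(p)\in\mathrm{dom}(f)$. Strong Weihrauch reducibility $f\le_{\mathrm{sW}}g$: there are computable partial $H,K:\subseteq\mathbb{N}^\mathbb{N}\to\mathbb{N}^\mathbb{N}$ with $H\circ G\circ K$ a realizer of $f$ for every realizer $G$ of $g$; $\equiv_{\mathrm{sW}}$ means both directions. $\mathbb{R}^n$ has the Euclidean metric and the Cauchy representation (names are sequences $(q_i)$ in $\mathbb{Q}^n$ with $d(q_i,q_j)\le2^{-i}$ for $j\ge i$, naming the limit). Basic balls are open balls $B(c,r)$ with $c\in\mathbb{Q}^n$, $r$ a nonnegative rational. $\mathcal{A}_-(\mathbb{R}^n)$ (negative information): a name of a closed set $A$ enumerates basic balls whose union is $\mathbb{R}^n\setminus A$. For $\varepsilon>0$, $x\in\mathbb{R}^n$ and nonempty closed $A$, an $\varepsilon$-projection point of $x$ onto $A$ is $y\in A$ with $d(x,y)\le(1+\varepsilon)\,d(x,A)$. $\varepsilon\text{-}\operatorname{Proj}^-_{\mathbb{R}^n}:\subseteq\mathbb{R}^n\times\mathcal{A}_-(\mathbb{R}^n)\rightrightarrows\mathbb{R}^n$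 maps $(x,A)$, $A\ne\emptyset$, to the set of $\varepsilon$-projection points of $x$ onto $A$ ($\varepsilon$ is fixed, not part of the input). Closed choice $\operatorname{C}_\mathbb{R}:\subseteq\mathcal{A}_-(\mathbb{R})\rightrightarrows\mathbb{R}$ maps each nonempty closed $A\subseteq\mathbb{R}$ (negative information) to the set $A$. *)

theory Defs
  imports "HOL-Analysis.Analysis" "HOL-Library.Nat_Bijection" "HOL-Library.Sublist"
begin

datatype recf = Zero | Succ | Proj nat | Comp recf "recf list" | Prim recf recf | Mu recf

inductive eval_recf :: "recf \<Rightarrow> nat list \<Rightarrow> nat \<Rightarrow> bool" where
  zero: "eval_recf Zero xs 0"
| succ: "eval_recf Succ (x # xs) (Suc x)"
| proj: "i < length xs \<Longrightarrow> eval_recf (Proj i) xs (xs ! i)"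
| comp: "length ys = length gs \<Longrightarrow> (\<forall>i < length gs. eval_recf (gs ! i) xs (ys ! i))
          \<Longrightarrow> eval_recf f ys z \<Longrightarrow> eval_recf (Comp f gs) xs z"
| prim0: "eval_recf f xs y \<Longrightarrow> eval_recf (Prim f g) (0 # xs) y"
| primS: "eval_recf (Prim f g) (n # xs) y \<Longrightarrow> eval_recf g (n # y # xs) z
          \<Longrightarrow> eval_recf (Prim f g) (Suc n # xs) z"
| mu: "eval_recf f (n # xs) 0 \<Longrightarrow> (\<forall>m < n. \<exists>y. eval_recf f (m # xs) (Suc y))
          \<Longrightarrow> eval_recf (Mu f) xs n"

definition computable_nat :: "(nat \<Rightarrow> nat) \<Rightarrow> bool" where
  "computable_nat f \<longleftrightarrow> (\<exists>r. \<forall>x. eval_recf r [x] (f x))"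

definition computable_word :: "(nat list \<Rightarrow> nat list) \<Rightarrow> bool" where
  "computable_word h \<longleftrightarrow> computable_nat (\<lambda>k. list_encode (h (list_decode k)))"

type_synonym baire = "nat \<Rightarrow> nat"

definition initial_seg :: "baire \<Rightarrow> nat \<Rightarrow> nat list" where
  "initial_seg p m = map p [0..<m]"

text \<open>A partial function H on Baire space (None = undefined) is computable if it is
  computed (on its domain) by a computable prefix-monotone word function, in the sense of
  Type-2 computability: the output is the limit of the outputs on longer and longer prefixes.\<close>
definition computable_pf :: "(baire \<Rightarrow> baire option) \<Rightarrow> bool" where
  "computable_pf H \<longleftrightarrow> (\<exists>h. computable_word h \<and> (\<forall>u v. prefix u v \<longrightarrow> prefix (h u) (h v)) \<and>
     (\<forall>p q. H p = Some q \<longrightarrow>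
        (\<forall>k. \<exists>m. k < length (h (initial_seg p m)) \<and> h (initial_seg p m) ! k = q k)))"

text \<open>A representation is a partial map baire to 'a (None = not a name).
  A partial multi-valued function f is given as 'a to 'b set; its domain is the set of
  x with f x nonempty.\<close>

definition realizes ::
  "(baire \<Rightarrow> 'a option) \<Rightarrow> (baire \<Rightarrow> 'b option) \<Rightarrow> ('a \<Rightarrow> 'b set) \<Rightarrow> (baire \<Rightarrow> baire option) \<Rightarrow> bool" where
  "realizes \<delta>X \<delta>Y f F \<longleftrightarrow>
     (\<forall>p x. \<delta>X p = Some x \<longrightarrow> f x \<noteq> {} \<longrightarrow> (\<exists>q y. F p = Some q \<and> \<delta>Y q = Some y \<and> y \<in> f x))"

definition sW_le ::
  "('a \<Rightarrow> 'b set) \<Rightarrow> (baire \<Rightarrow> 'a option) \<Rightarrow> (baire \<Rightarrow> 'b option) \<Rightarrow>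
   ('c \<Rightarrow> 'd set) \<Rightarrow> (baire \<Rightarrow> 'c option) \<Rightarrow> (baire \<Rightarrow> 'd option) \<Rightarrow> bool" where
  "sW_le f \<delta>X \<delta>Y g \<delta>Z \<delta>W \<longleftrightarrow>
     (\<exists>H K. computable_pf H \<and> computable_pf K \<and>
        (\<forall>G. realizes \<delta>Z \<delta>W g G \<longrightarrow>
             realizes \<delta>X \<delta>Y f (\<lambda>p. Option.bind (K p) (\<lambda>r. Option.bind (G r) H))))"

definition sW_equiv ::
  "('a \<Rightarrow> 'b set) \<Rightarrow> (baire \<Rightarrow> 'a option) \<Rightarrow> (baire \<Rightarrow> 'b option) \<Rightarrow>
   ('c \<Rightarrow> 'd set) \<Rightarrow> (baire \<Rightarrow> 'c option) \<Rightarrow> (baire \<Rightarrow> 'd option) \<Rightarrow> bool" where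
  "sW_equiv f \<delta>X \<delta>Y g \<delta>Z \<delta>W \<longleftrightarrow> sW_le f \<delta>X \<delta>Y g \<delta>Z \<delta>W \<and> sW_le g \<delta>Z \<delta>W f \<delta>X \<delta>Y"

definition rat_code :: "nat \<Rightarrow> real" where
  "rat_code k = (case prod_decode k of (a, b) \<Rightarrow> real_of_int (int_decode a) / real (Suc b))"

definition nnrat_code :: "nat \<Rightarrow> real" where
  "nnrat_code k = (case prod_decode k of (a, b) \<Rightarrow> real a / real (Suc b))"

definition vec_code :: "nat \<Rightarrow> real ^ 'n::enum" where
  "vec_code k = (\<chi> i. case map_of (zip (enum_class.enum :: 'n list) (list_decode k)) i of
                         None \<Rightarrow> 0 | Some c \<Rightarrow> rat_code c)"

definition cauchy_rep :: "(nat \<Rightarrow> 'a::metric_space) \<Rightarrow> baire \<Rightarrow> 'a option" where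
  "cauchy_rep \<alpha> p =
     (if (\<forall>i j. i \<le> j \<longrightarrow> dist (\<alpha> (p i)) (\<alpha> (p j)) \<le> (1/2) ^ i)
      then Some (lim (\<lambda>i. \<alpha> (p i))) else None)"

definition neg_rep :: "(nat \<Rightarrow> 'a::metric_space) \<Rightarrow> baire \<Rightarrow> 'a set option" where
  "neg_rep \<alpha> p =
     Some (- (\<Union>i. ball (\<alpha> (fst (prod_decode (p i)))) (nnrat_code (snd (prod_decode (p i))))))"

definition pair_rep :: "(baire \<Rightarrow> 'a option) \<Rightarrow> (baire \<Rightarrow> 'b option) \<Rightarrow> baire \<Rightarrow> ('a \<times> 'b) option" where
  "pair_rep \<delta>1 \<delta>2 r =
     (case (\<delta>1 (\<lambda>i. r (2 * i)), \<delta>2 (\<lambda>i. r (2 * i + 1))) of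
        (Some x, Some y) \<Rightarrow> Some (x, y) | _ \<Rightarrow> None)"

definition eps_proj :: "real \<Rightarrow> ('a::metric_space \<times> 'a set) \<Rightarrow> 'a set" where
  "eps_proj \<epsilon> xA = (case xA of (x, A) \<Rightarrow>
     (if A = {} then {} else {y \<in> A. dist x y \<le> (1 + \<epsilon>) * infdist x A}))"

definition closed_choice :: "'a set \<Rightarrow> 'a set" where
  "closed_choice A = A"

end

(* Closed choice reduces to projection by sending A to the cylinder of all v with v_0 in A, and 0 to
   the point to be projected.

   Conversely, a point of a closed set of reals encodes a guess (s, N, c) and a point y of the unit
   cube at c, such that y is in A, d(x, y) <= (1 + e) s for a rational e < epsilon, and
   the first N removed balls cover the open ball B(x, s), so that s <= d(x, A).  Each of these
   conditions is refuted at finite precision when it fails.  If d(x, A) = 0 the guess s = 0 is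
   correct, and otherwise compactness provides N for any rational s with
   d(x, A) / (1 + e) <= s < d(x, A).  The guess is the integer part of the real number, and the binary
   digits of y are its further digits in so large a base that the expansion can be read off from
   approximations. *)

theory Submission
  imports Defs
begin

section \<open>Recursive functions\<close>

text \<open>Two obstacles shape the harder reduction, from projection to closed choice. It is
  strong: the outer function sees only a name of the chosen real and not the input, so this real
  alone has to yield the approximated point. And A is known only from outside: a claim
  \<open>s <= d(x, A)\<close> fails because of a point of A near x, which negative information never
  confirms. The number N turns the claim into a finite covering statement whose failure can be
  observed. The corner c is guessed because A may be unbounded while binary digits only describe a
  unit cube. The rational e is there because epsilon may be uncomputable.

  Integer parts and digits are discontinuous functions of a real number. This leaves gaps between
  the cells of every level, and rounding a good approximation finds the right cell. The price is
  that digits must stay below about a third of the base.\<close>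

definition recursive :: "nat \<Rightarrow> (nat list \<Rightarrow> nat) \<Rightarrow> bool" where
  "recursive k f \<longleftrightarrow> (\<exists>r. \<forall>xs. length xs = k \<longrightarrow> eval_recf r xs (f xs))"

lemma recursive_Suc: "recursive 1 (\<lambda>xs. Suc (xs ! 0))"
proof -
  have "eval_recf Succ xs (Suc (xs ! 0))" if "length xs = 1" for xs
    using that eval_recf.succ by (cases xs) auto
  then show ?thesis
    unfolding recursive_def by blast
qed

lemma recursive_zero: "recursive k (\<lambda>xs. 0)"
  unfolding recursive_def using eval_recf.zero by blast

lemma recursive_nth: "i < k \<Longrightarrow> recursive k (\<lambda>xs. xs ! i)"
  unfolding recursive_def using eval_recf.proj by blast

lemma recursive_comp:
  assumes "recursive (length Gs) F" and "\<And>G. G \<in> set Gs \<Longrightarrow> recursive k G"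
  shows "recursive k (\<lambda>xs. F (map (\<lambda>G. G xs) Gs))"
proof -
  obtain f where f: "\<And>ys. length ys = length Gs \<Longrightarrow> eval_recf f ys (F ys)"
    using assms(1) unfolding recursive_def by blast
  have "\<forall>G \<in> set Gs. \<exists>g. \<forall>xs. length xs = k \<longrightarrow> eval_recf g xs (G xs)"
    using assms(2) unfolding recursive_def by blast
  then obtain g where g: "\<And>G xs. G \<in> set Gs \<Longrightarrow> length xs = k \<Longrightarrow> eval_recf (g G) xs (G xs)"
    by metis
  have "eval_recf (Comp f (map g Gs)) xs (F (map (\<lambda>G. G xs) Gs))" if "length xs = k" for xs
    by (rule eval_recf.comp[where ys = "map (\<lambda>G. G xs) Gs"]) (use f g that in auto)
  then show ?thesis
    unfolding recursive_def by blast
qed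

lemma recursive_comp1:
  assumes "recursive 1 (\<lambda>xs. f (xs ! 0))" and "recursive k g"
  shows "recursive k (\<lambda>xs. f (g xs))"
  using recursive_comp[of "[g]" "\<lambda>xs. f (xs ! 0)" k] assms by simp

lemma recursive_comp2:
  assumes "recursive 2 (\<lambda>xs. f (xs ! 0) (xs ! 1))" and "recursive k g" and "recursive k h"
  shows "recursive k (\<lambda>xs. f (g xs) (h xs))"
  using recursive_comp[of "[g, h]" "\<lambda>xs. f (xs ! 0) (xs ! 1)" k] assms
  by (auto simp: numeral_2_eq_2)

lemma recursive_rec_nat:
  assumes "recursive 1 (\<lambda>xs. f (xs ! 0))"
    and "recursive 3 (\<lambda>xs. g (xs ! 0) (xs ! 1) (xs ! 2))"
  shows "recursive 2 (\<lambda>xs. rec_nat (f (xs ! 1)) (\<lambda>n y. g n y (xs ! 1)) (xs ! 0))"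
proof -
  obtain rf where rf: "\<And>xs. length xs = 1 \<Longrightarrow> eval_recf rf xs (f (xs ! 0))"
    using assms(1) unfolding recursive_def by blast
  obtain rg where rg: "\<And>xs. length xs = 3 \<Longrightarrow> eval_recf rg xs (g (xs ! 0) (xs ! 1) (xs ! 2))"
    using assms(2) unfolding recursive_def by blast
  have *: "eval_recf (Prim rf rg) [n, x] (rec_nat (f x) (\<lambda>n y. g n y x) n)" for n x
  proof (induction n)
    case 0
    show ?case using rf[of "[x]"] by (auto intro: eval_recf.prim0)
  next
    case (Suc n)
    show ?case
      using eval_recf.primS[OF Suc, of "g n (rec_nat (f x) (\<lambda>n y. g n y x) n) x"] rg[of "[n, _, x]"]
      by simp
  qed
  have "eval_recf (Prim rf rg) xs (rec_nat (f (xs ! 1)) (\<lambda>n y. g n y (xs ! 1)) (xs ! 0))"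
    if "length xs = 2" for xs
    using that *[of "xs ! 0" "xs ! 1"] by (cases xs; cases "tl xs") auto
  then show ?thesis
    unfolding recursive_def by blast
qed

lemma recursive_rec_nat_unary:
  assumes "recursive 2 (\<lambda>xs. g (xs ! 0) (xs ! 1))"
  shows "recursive 1 (\<lambda>xs. rec_nat 0 g (xs ! 0))"
proof -
  have "recursive 2 (\<lambda>xs. rec_nat 0 (\<lambda>n y. g n y) (xs ! 0))"
    by (rule recursive_rec_nat)
      (auto intro!: recursive_zero recursive_comp2[OF assms] recursive_nth)
  from recursive_comp2[OF this recursive_nth recursive_nth] show ?thesis
    by simp
qed

lemma recursive_add: "recursive 2 (\<lambda>xs. xs ! 0 + xs ! 1)"
proof -
  have "rec_nat y (\<lambda>n r. Suc r) x = x + y" for x y :: nat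
    by (induction x) auto
  then show ?thesis
    using recursive_rec_nat[where f = "\<lambda>x. x" and g = "\<lambda>n y x. Suc y"]
    by (simp add: recursive_nth recursive_comp1[OF recursive_Suc])
qed

lemma recursive_mult: "recursive 2 (\<lambda>xs. xs ! 0 * xs ! 1)"
proof -
  have "rec_nat 0 (\<lambda>n r. r + y) x = x * y" for x y :: nat
    by (induction x) auto
  then show ?thesis
    using recursive_rec_nat[where f = "\<lambda>x. 0" and g = "\<lambda>n y x. y + x"]
    by (simp add: recursive_nth recursive_zero recursive_comp2[OF recursive_add])
qed

lemma recursive_pred: "recursive 1 (\<lambda>xs. xs ! 0 - 1)"
proof -
  have "rec_nat 0 (\<lambda>n r. n) x = x - 1" for x :: nat
    by (induction x) auto
  then show ?thesis
    using recursive_rec_nat_unary[where g = "\<lambda>n r. n"] by (simp add: recursive_nth)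
qed

lemma recursive_diff: "recursive 2 (\<lambda>xs. xs ! 0 - xs ! 1)"
proof -
  have "rec_nat y (\<lambda>n r. r - 1) x = y - x" for x y :: nat
    by (induction x) auto
  then have "recursive 2 (\<lambda>xs. xs ! 1 - xs ! 0)"
    using recursive_rec_nat[where f = "\<lambda>x. x" and g = "\<lambda>n y x. y - 1"]
      recursive_comp1[OF recursive_pred]
    by (simp add: recursive_nth)
  from recursive_comp2[OF this, of 2 "\<lambda>xs. xs ! 1" "\<lambda>xs. xs ! 0"] show ?thesis
    by (simp add: recursive_nth)
qed

lemma recursive_triangle: "recursive 1 (\<lambda>xs. triangle (xs ! 0))"
proof -
  have "rec_nat 0 (\<lambda>n r. r + Suc n) x = triangle x" for x :: nat
    by (induction x) auto
  moreover have "recursive 2 (\<lambda>xs. xs ! 1 + Suc (xs ! 0))"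
    by (intro recursive_comp2[OF recursive_add] recursive_comp1[OF recursive_Suc] recursive_nth) auto
  ultimately show ?thesis
    using recursive_rec_nat_unary[where g = "\<lambda>n r. r + Suc n"] by simp
qed

lemma recursive_prod_encode: "recursive 2 (\<lambda>xs. prod_encode (xs ! 0, xs ! 1))"
  unfolding prod_encode_def prod.case
  by (intro recursive_comp2[OF recursive_add] recursive_comp1[OF recursive_triangle] recursive_nth) auto

text \<open>The index of the antidiagonal of Cantor's pairing on which \<open>k\<close> lies, that
  is, the largest \<open>d\<close> with \<open>triangle d <= k\<close>. Together with
  \<open>k\<close> it determines both components, so computing it is enough to compute
  \<open>prod_decode\<close>.\<close>

definition diagonal :: "nat \<Rightarrow> nat" where
  "diagonal k = fst (prod_decode k) + snd (prod_decode k)"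

lemma prod_decode_diagonal:
  "prod_decode k = (k - triangle (diagonal k), diagonal k - (k - triangle (diagonal k)))"
proof -
  obtain a b where ab: "prod_decode k = (a, b)" by fastforce
  then have "k = triangle (a + b) + a"
    using prod_decode_inverse[of k] by (simp add: prod_encode_def)
  then show ?thesis
    using ab by (simp add: diagonal_def)
qed

text \<open>Truncated subtraction acts as a test: the inner difference vanishes exactly when
  \<open>k\<close> is the last number on its antidiagonal. This gives a primitive recursion for
  \<open>diagonal\<close>, with no search.\<close>

lemma diagonal_Suc:
  "diagonal (Suc k) = diagonal k + (1 - (triangle (Suc (diagonal k)) - Suc k))"
proof -
  obtain a b where ab: "prod_decode k = (a, b)" by fastforce
  then have k: "k = triangle (a + b) + a"
    using prod_decode_inverse[of k] by (simp add: prod_encode_def)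
  show ?thesis
  proof (cases b)
    case 0
    then have "Suc k = prod_encode (0, Suc a)"
      using k by (simp add: prod_encode_def)
    then have "diagonal (Suc k) = Suc a"
      by (simp only: diagonal_def prod_encode_inverse) simp
    then show ?thesis
      using 0 ab k by (simp add: diagonal_def)
  next
    case (Suc c)
    then have "Suc k = prod_encode (Suc a, c)"
      using k by (simp add: prod_encode_def)
    then have "diagonal (Suc k) = Suc a + c"
      by (simp only: diagonal_def prod_encode_inverse) simp
    then show ?thesis
      using Suc ab k by (simp add: diagonal_def)
  qed
qed

lemma prod_decode_0 [simp]: "prod_decode 0 = (0, 0)"
  by (simp add: prod_decode_def prod_decode_aux.simps)

lemma recursive_diagonal: "recursive 1 (\<lambda>xs. diagonal (xs ! 0))"
proof -
  have "rec_nat 0 (\<lambda>k r. r + ((Suc 0) - (triangle (Suc r) - Suc k))) x = diagonal x" for x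
    by (induction x) (simp_all add: diagonal_Suc, simp add: diagonal_def)
  moreover have "recursive 2 (\<lambda>xs. xs ! 1 + ((Suc 0) - (triangle (Suc (xs ! 1)) - Suc (xs ! 0))))"
    by (intro recursive_comp2[OF recursive_add] recursive_comp2[OF recursive_diff]
        recursive_comp1[OF recursive_Suc] recursive_comp1[OF recursive_triangle]
        recursive_nth recursive_zero) auto
  ultimately show ?thesis
    using recursive_rec_nat_unary[where g = "\<lambda>k r. r + ((Suc 0) - (triangle (Suc r) - Suc k))"] by simp
qed

lemma computable_nat_recursive: "computable_nat f \<longleftrightarrow> recursive 1 (\<lambda>xs. f (xs ! 0))"
proof -
  have "(\<forall>x. eval_recf r [x] (f x)) \<longleftrightarrow> (\<forall>xs. length xs = 1 \<longrightarrow> eval_recf r xs (f (xs ! 0)))" for r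
    by (auto simp: length_Suc_conv)
  then show ?thesis
    unfolding computable_nat_def recursive_def by simp
qed

section \<open>Closure rules for computable unary functions and decidable predicates\<close>

named_theorems computable_intros

lemma computable_comp: "computable_nat f \<Longrightarrow> computable_nat g \<Longrightarrow> computable_nat (\<lambda>x. f (g x))"
  unfolding computable_nat_recursive by (rule recursive_comp1)

lemma computable_comp2:
  "recursive 2 (\<lambda>xs. f (xs ! 0) (xs ! 1)) \<Longrightarrow> computable_nat g \<Longrightarrow> computable_nat h
    \<Longrightarrow> computable_nat (\<lambda>x. f (g x) (h x))"
  unfolding computable_nat_recursive by (rule recursive_comp2)

lemma computable_id [computable_intros]: "computable_nat (\<lambda>x. x)"
  unfolding computable_nat_recursive by (simp add: recursive_nth)

lemma computable_Suc [computable_intros]: "computable_nat f \<Longrightarrow> computable_nat (\<lambda>x. Suc (f x))"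
  unfolding computable_nat_recursive by (rule recursive_comp1[OF recursive_Suc])

lemma computable_const [computable_intros]: "computable_nat (\<lambda>x. c)"
proof (induction c)
  case 0
  show ?case unfolding computable_nat_recursive by (rule recursive_zero)
qed (rule computable_Suc)

lemmas computable_add [computable_intros] = computable_comp2[OF recursive_add]
lemmas computable_mult [computable_intros] = computable_comp2[OF recursive_mult]
lemmas computable_diff [computable_intros] = computable_comp2[OF recursive_diff]
lemmas computable_prod_encode [computable_intros] = computable_comp2[OF recursive_prod_encode]

lemma computable_diagonal: "computable_nat f \<Longrightarrow> computable_nat (\<lambda>x. diagonal (f x))"
  using recursive_diagonal recursive_comp1 unfolding computable_nat_recursive by auto

lemma computable_triangle: "computable_nat f \<Longrightarrow> computable_nat (\<lambda>x. triangle (f x))"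
  using recursive_triangle recursive_comp1 unfolding computable_nat_recursive by auto

lemma computable_fst [computable_intros]:
  "computable_nat f \<Longrightarrow> computable_nat (\<lambda>x. fst (prod_decode (f x)))"
  unfolding prod_decode_diagonal fst_conv
  by (intro computable_diff computable_triangle computable_diagonal)

lemma computable_snd [computable_intros]:
  "computable_nat f \<Longrightarrow> computable_nat (\<lambda>x. snd (prod_decode (f x)))"
  unfolding prod_decode_diagonal snd_conv
  by (intro computable_diff computable_triangle computable_diagonal)

text \<open>Wraps the binary hypothesis of rules such as the one for bounded sums into a constant,
  which \<open>computable_nat2D\<close> can then instantiate at arbitrary computable
  arguments.\<close>

definition computable_nat2 :: "(nat \<Rightarrow> nat \<Rightarrow> nat) \<Rightarrow> bool" where
  "computable_nat2 f \<longleftrightarrow> computable_nat (\<lambda>x. f (fst (prod_decode x)) (snd (prod_decode x)))"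

lemma computable_nat2D:
  assumes "computable_nat2 f" "computable_nat g" "computable_nat h"
  shows "computable_nat (\<lambda>x. f (g x) (h x))"
  using computable_comp[OF assms(1)[unfolded computable_nat2_def] computable_prod_encode[OF assms(2,3)]]
  by simp

lemma computable_rec_nat [computable_intros]:
  assumes "computable_nat f"
    and "computable_nat (\<lambda>t. g (fst (prod_decode t)) (fst (prod_decode (snd (prod_decode t))))
           (snd (prod_decode (snd (prod_decode t)))))"
    and "computable_nat h"
  shows "computable_nat (\<lambda>x. rec_nat (f x) (\<lambda>n y. g n y x) (h x))"
proof -
  have "recursive 3 (\<lambda>xs. prod_encode (xs ! 0, prod_encode (xs ! 1, xs ! 2)))"
    by (intro recursive_comp2[OF recursive_prod_encode] recursive_nth) auto
  from recursive_comp1[OF assms(2)[unfolded computable_nat_recursive] this]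
  have "recursive 3 (\<lambda>xs. g (xs ! 0) (xs ! 1) (xs ! 2))"
    by simp
  with recursive_rec_nat[of f g] assms(1)
  have "recursive 2 (\<lambda>xs. rec_nat (f (xs ! 1)) (\<lambda>n y. g n y (xs ! 1)) (xs ! 0))"
    unfolding computable_nat_recursive by blast
  from computable_comp2[OF this assms(3) computable_id] show ?thesis .
qed

lemma computable_power [computable_intros]:
  assumes "computable_nat f" "computable_nat g"
  shows "computable_nat (\<lambda>x. f x ^ g x)"
proof -
  have "rec_nat 1 (\<lambda>n y. a * y) k = a ^ k" for a k :: nat
    by (induction k) auto
  moreover have "computable_nat (\<lambda>x. rec_nat 1 (\<lambda>n y. f x * y) (g x))"
    by (intro computable_rec_nat computable_mult computable_comp[OF assms(1)] assms computable_intros)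
  ultimately show ?thesis by simp
qed

lemma computable_sum [computable_intros]:
  assumes "computable_nat (\<lambda>t. f (fst (prod_decode t)) (snd (prod_decode t)))" "computable_nat g"
  shows "computable_nat (\<lambda>x. \<Sum>i<g x. f i x)"
proof -
  have "rec_nat 0 (\<lambda>n y. y + f n x) k = (\<Sum>i<k. f i x)" for k x
    by (induction k) auto
  moreover have "computable_nat (\<lambda>x. rec_nat 0 (\<lambda>n y. y + f n x) (g x))"
    by (intro computable_rec_nat assms computable_intros
        computable_nat2D[of f] assms(1)[folded computable_nat2_def])
  ultimately show ?thesis by simp
qed

definition decidable :: "(nat \<Rightarrow> bool) \<Rightarrow> bool" where
  "decidable P \<longleftrightarrow> computable_nat (\<lambda>x. if P x then 1 else 0)"

lemma decidable_less [computable_intros]: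
  assumes "computable_nat f" "computable_nat g"
  shows "decidable (\<lambda>x. f x < g x)"
proof -
  have "computable_nat (\<lambda>x. 1 - (Suc (f x) - g x))"
    by (intro assms computable_intros)
  moreover have "1 - (Suc (f x) - g x) = (if f x < g x then 1 else 0)" for x
    by auto
  ultimately show ?thesis unfolding decidable_def by simp
qed

lemma decidable_not [computable_intros]:
  assumes "decidable P"
  shows "decidable (\<lambda>x. \<not> P x)"
proof -
  have "computable_nat (\<lambda>x. 1 - (if P x then 1 else 0))"
    using assms unfolding decidable_def by (intro computable_intros)
  moreover have "1 - (if P x then 1 else 0) = (if \<not> P x then 1 else (0::nat))" for x
    by auto
  ultimately show ?thesis unfolding decidable_def by simp
qed

lemma decidable_conj [computable_intros]:
  assumes "decidable P" "decidable Q"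
  shows "decidable (\<lambda>x. P x \<and> Q x)"
proof -
  have "computable_nat (\<lambda>x. (if P x then 1 else 0) * (if Q x then 1 else 0))"
    using assms unfolding decidable_def by (intro computable_intros)
  moreover have "(if P x then 1 else 0) * (if Q x then 1 else 0) = (if P x \<and> Q x then 1 else (0::nat))" for x
    by auto
  ultimately show ?thesis unfolding decidable_def by simp
qed

lemma decidable_disj [computable_intros]:
  assumes "decidable P" "decidable Q"
  shows "decidable (\<lambda>x. P x \<or> Q x)"
  using decidable_not[OF decidable_conj[OF decidable_not decidable_not]] assms by auto

lemma decidable_le [computable_intros]:
  "computable_nat f \<Longrightarrow> computable_nat g \<Longrightarrow> decidable (\<lambda>x. f x \<le> g x)"
  using decidable_not[OF decidable_less] by (simp add: not_less)

lemma decidable_eq [computable_intros]: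
  "computable_nat f \<Longrightarrow> computable_nat g \<Longrightarrow> decidable (\<lambda>x. f x = g x)"
  unfolding order_eq_iff by (intro computable_intros)

lemma computable_if [computable_intros]:
  assumes "decidable P" "computable_nat f" "computable_nat g"
  shows "computable_nat (\<lambda>x. if P x then f x else g x)"
proof -
  have "computable_nat (\<lambda>x. (if P x then 1 else 0) * f x + (1 - (if P x then 1 else 0)) * g x)"
    using assms unfolding decidable_def by (intro computable_intros)
  moreover have "(if P x then 1 else 0) * f x + (1 - (if P x then 1 else 0)) * g x = (if P x then f x else g x)" for x
    by auto
  ultimately show ?thesis by simp
qed

lemma decidable_ex_less [computable_intros]:
  assumes "decidable (\<lambda>t. P (fst (prod_decode t)) (snd (prod_decode t)))" "computable_nat g"
  shows "decidable (\<lambda>x. \<exists>i<g x. P i x)"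
proof -
  have "decidable (\<lambda>x. 0 < (\<Sum>i<g x. if P i x then 1 else (0::nat)))"
    using assms(1) unfolding decidable_def[of "\<lambda>t. P _ _"] by (intro computable_intros assms(2))
  moreover have "0 < (\<Sum>i<g x. if P i x then 1 else (0::nat)) \<longleftrightarrow> (\<exists>i<g x. P i x)" for x
    by (auto simp: sum.inter_filter[symmetric] card_gt_0_iff)
  ultimately show ?thesis by simp
qed

lemma decidable_all_less [computable_intros]:
  assumes "decidable (\<lambda>t. P (fst (prod_decode t)) (snd (prod_decode t)))" "computable_nat g"
  shows "decidable (\<lambda>x. \<forall>i<g x. P i x)"
  using decidable_not[OF decidable_ex_less[OF decidable_not]] assms by auto

text \<open>For \<open>b > 0\<close>, \<open>a div b\<close> counts the positive multiples of
  \<open>b\<close> up to \<open>a\<close>. For \<open>b = 0\<close> the same count would give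
  \<open>a\<close> instead of 0, hence the case distinction.\<close>

lemma computable_div [computable_intros]:
  assumes "computable_nat f" "computable_nat g"
  shows "computable_nat (\<lambda>x. f x div g x)"
proof -
  have "computable_nat (\<lambda>x. if g x = 0 then 0 else \<Sum>i<f x. if Suc i * g x \<le> f x then 1 else (0::nat))"
    by (intro computable_if computable_sum decidable_eq decidable_le computable_mult assms
        computable_comp[OF assms(1)] computable_comp[OF assms(2)] computable_intros)
  moreover have "(if b = 0 then 0 else \<Sum>i<a. if Suc i * b \<le> a then 1 else (0::nat)) = a div b" for a b
  proof (cases "b = 0")
    case False
    then have "{i \<in> {..<a}. Suc i * b \<le> a} = {..<a div b}"
      using less_le_trans[OF _ div_le_dividend[of a b]]
      by (auto simp: less_eq_div_iff_mult_less_eq[symmetric] Suc_le_eq simp del: mult_Suc)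
    then show ?thesis
      using False by (simp add: sum.inter_filter[symmetric] del: mult_Suc)
  qed simp
  ultimately show ?thesis by simp
qed

lemma computable_mod [computable_intros]:
  "computable_nat f \<Longrightarrow> computable_nat g \<Longrightarrow> computable_nat (\<lambda>x. f x mod g x)"
  unfolding modulo_nat_def by (intro computable_intros)

section \<open>Codes of words and functions on Baire space\<close>

definition code_tl :: "nat \<Rightarrow> nat" where
  "code_tl k = snd (prod_decode (k - 1))"

text \<open>\<open>prod_decode 0 = (0, 0)\<close> makes every entry beyond the end of the word 0.\<close>

definition code_nth :: "nat \<Rightarrow> baire" where
  "code_nth k i = fst (prod_decode ((code_tl ^^ i) k - 1))"

lemma code_tl_list_encode: "code_tl (list_encode xs) = list_encode (tl xs)"
  by (cases xs) (simp_all add: code_tl_def)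

lemma code_tl_funpow: "(code_tl ^^ i) k = list_encode (drop i (list_decode k))"
  by (induction i) (simp_all add: code_tl_list_encode drop_Suc tl_drop)

lemma code_nth_eq:
  "code_nth k i = (if i < length (list_decode k) then list_decode k ! i else 0)"
  by (auto simp: code_nth_def code_tl_funpow Cons_nth_drop_Suc[symmetric])

lemma computable_code_tl_funpow [computable_intros]:
  assumes "computable_nat f" "computable_nat g"
  shows "computable_nat (\<lambda>x. (code_tl ^^ f x) (g x))"
proof -
  have "rec_nat k (\<lambda>n y. code_tl y) i = (code_tl ^^ i) k" for i k
    by (induction i) simp_all
  moreover have "computable_nat (\<lambda>x. rec_nat (g x) (\<lambda>n y. code_tl y) (f x))"
    unfolding code_tl_def by (intro assms computable_intros)
  ultimately show ?thesis by simp
qed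

lemma computable_code_nth [computable_intros]:
  "computable_nat f \<Longrightarrow> computable_nat g \<Longrightarrow> computable_nat (\<lambda>x. code_nth (f x) (g x))"
  unfolding code_nth_def by (intro computable_intros)

lemma length_list_decode_le: "length (list_decode k) \<le> k"
proof -
  have "length xs \<le> list_encode xs" for xs
  proof (induction xs)
    case (Cons x xs)
    then show ?case
      using le_prod_encode_2[of "list_encode xs" x] by simp
  qed simp
  from this[of "list_decode k"] show ?thesis by simp
qed

text \<open>Only the empty word has code 0, so the length is the number of nonzero iterated tails. A
  word is never longer than its code, which bounds the count.\<close>

lemma computable_length [computable_intros]:
  assumes "computable_nat f"
  shows "computable_nat (\<lambda>x. length (list_decode (f x)))"
proof -
  have "computable_nat (\<lambda>k. \<Sum>i<k. if (code_tl ^^ i) k = 0 then 0 else 1)"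
    by (intro computable_intros)
  moreover have "(\<Sum>i<k. if (code_tl ^^ i) k = 0 then 0 else 1) = length (list_decode k)" for k
  proof -
    have "(code_tl ^^ i) k = 0 \<longleftrightarrow> length (list_decode k) \<le> i" for i
      using list_encode_eq[of "drop i (list_decode k)" "[]"] by (simp add: code_tl_funpow)
    moreover have "{..<k} \<inter> - {i. length (list_decode k) \<le> i} = {..<length (list_decode k)}"
      using length_list_decode_le[of k] by auto
    ultimately show ?thesis
      by (simp add: sum.If_cases)
  qed
  ultimately have "computable_nat (\<lambda>k. length (list_decode k))" by simp
  from computable_comp[OF this assms] show ?thesis .
qed

text \<open>List codes grow at the head, so the recursion runs backwards: after \<open>j\<close>
  steps it holds the code of the last \<open>j\<close> entries.\<close>

lemma computable_list_encode_map_upt: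
  assumes "computable_nat (\<lambda>t. f (fst (prod_decode t)) (snd (prod_decode t)))" "computable_nat g"
  shows "computable_nat (\<lambda>x. list_encode (map (\<lambda>i. f i x) [0..<g x]))"
proof -
  have "rec_nat 0 (\<lambda>j y. Suc (prod_encode (f (n - Suc j) x, y))) j
      = list_encode (map (\<lambda>i. f i x) [n - j..<n])" if "j \<le> n" for j n x
    using that
  proof (induction j)
    case (Suc j)
    then have "[n - Suc j..<n] = (n - Suc j) # [n - j..<n]"
      using upt_conv_Cons[of "n - Suc j" n] by (simp add: Suc_diff_Suc)
    then show ?case
      using Suc by simp
  qed simp
  from this[OF order_refl]
  have "list_encode (map (\<lambda>i. f i x) [0..<g x])
      = rec_nat 0 (\<lambda>j y. Suc (prod_encode (f (g x - Suc j) x, y))) (g x)" for x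
    by simp
  moreover have "computable_nat (\<lambda>x. rec_nat 0 (\<lambda>j y. Suc (prod_encode (f (g x - Suc j) x, y))) (g x))"
    by (intro computable_rec_nat computable_Suc computable_prod_encode
        computable_nat2D[of f] assms(1)[folded computable_nat2_def] computable_diff
        computable_comp[OF assms(2)] assms(2) computable_intros)
  ultimately show ?thesis by simp
qed

text \<open>The hypothesis \<open>local\<close> says that the \<open>k\<close>-th output symbol only depends on the first
  \<open>c * Suc k\<close> input symbols, so a prefix of length \<open>m\<close> determines \<open>m div c\<close> output symbols.\<close>

lemma computable_pfI:
  fixes F :: "baire \<Rightarrow> baire"
  assumes comp: "computable_nat (\<lambda>t. F (code_nth (fst (prod_decode t))) (snd (prod_decode t)))"
    and "c > 0"
    and local: "\<And>p p' k. (\<And>i. i < c * Suc k \<Longrightarrow> p i = p' i) \<Longrightarrow> F p k = F p' k"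
  shows "computable_pf (\<lambda>p. Some (F p))"
proof -
  \<comment> \<open>\<open>F\<close> is applied to the prefix \<open>u\<close> padded with zeros.
    Only those output symbols are kept that, by \<open>local\<close>, do not see the padding; this
    makes \<open>h\<close> monotone.\<close>
  define h where "h u = map (F (code_nth (list_encode u))) [0..<length u div c]" for u
  have idx: "i < m" if "k < m div c" "i < c * Suc k" for i k m
  proof -
    have "c * Suc k \<le> m"
      using that(1) \<open>c > 0\<close> by (metis Suc_leI less_eq_div_iff_mult_less_eq mult.commute)
    then show ?thesis using that(2) by simp
  qed
  have F: "computable_nat2 (\<lambda>u. F (code_nth u))"
    using comp unfolding computable_nat2_def .
  have "computable_nat (\<lambda>x. list_encode (map (\<lambda>i. F (code_nth x) i) [0..<length (list_decode x) div c]))"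
    by (intro computable_list_encode_map_upt computable_intros
        computable_nat2D[OF F])
  then have "computable_word h"
    unfolding computable_word_def h_def by simp
  moreover have "prefix (h u) (h v)" if "prefix u v" for u v
  proof -
    obtain w where v: "v = u @ w" using \<open>prefix u v\<close> unfolding prefix_def by blast
    have "F (code_nth (list_encode u)) k = F (code_nth (list_encode v)) k" if "k < length u div c" for k
    proof (rule local)
      fix i assume "i < c * Suc k"
      then have "i < length u" by (rule idx[OF that])
      then show "code_nth (list_encode u) i = code_nth (list_encode v) i"
        by (simp add: code_nth_eq v nth_append)
    qed
    then have "h u = map (F (code_nth (list_encode v))) [0..<length u div c]"
      unfolding h_def by simp
    moreover have "[0..<length v div c] = [0..<length u div c] @ [length u div c..<length v div c]"
      using upt_add_eq_append[of 0 "length u div c" "length v div c - length u div c"] v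
      by (simp add: div_le_mono)
    then have "h v = map (F (code_nth (list_encode v))) [0..<length u div c]
        @ map (F (code_nth (list_encode v))) [length u div c..<length v div c]"
      unfolding h_def by simp
    ultimately show ?thesis by simp
  qed
  moreover have "k < length (h (initial_seg p (c * Suc k))) \<and> h (initial_seg p (c * Suc k)) ! k = F p k" for p k
  proof -
    have "F (code_nth (list_encode (initial_seg p (c * Suc k)))) k = F p k"
      by (rule local) (auto simp: code_nth_eq initial_seg_def)
    then show ?thesis
      using \<open>c > 0\<close> unfolding h_def by (simp add: initial_seg_def nth_append del: mult_Suc_right)
  qed
  ultimately show ?thesis
    unfolding computable_pf_def by blast
qed

section \<open>Computable rational-valued functions\<close>

text \<open>Values stay in type \<open>real\<close>, so the closure rules apply directly to radii
  and coordinates. A difference of naturals over a successor handles signs and nonzero denominators,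
  and fractions need not be reduced.\<close>

definition computable_rat :: "(nat \<Rightarrow> real) \<Rightarrow> bool" where
  "computable_rat f \<longleftrightarrow> (\<exists>a b c. computable_nat a \<and> computable_nat b \<and> computable_nat c \<and>
     (\<forall>x. f x = (real (a x) - real (b x)) / real (Suc (c x))))"

lemma computable_ratI:
  assumes "computable_nat a" "computable_nat b" "computable_nat c"
    and "\<And>x. f x = (real (a x) - real (b x)) / real (Suc (c x))"
  shows "computable_rat f"
  using assms unfolding computable_rat_def by blast

lemma computable_ratE:
  assumes "computable_rat f"
  obtains a b c where "computable_nat a" "computable_nat b" "computable_nat c"
    "\<And>x. f x = (real (a x) - real (b x)) / real (Suc (c x))"
  using assms unfolding computable_rat_def by blast

lemma computable_rat_of_nat [computable_intros]:
  "computable_nat f \<Longrightarrow> computable_rat (\<lambda>x. real (f x))"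
  by (rule computable_ratI[of f "\<lambda>x. 0" "\<lambda>x. 0"]) (simp_all add: computable_const)

lemma computable_rat_add [computable_intros]:
  assumes "computable_rat f" "computable_rat g"
  shows "computable_rat (\<lambda>x. f x + g x)"
proof -
  obtain a b c a' b' c' where
    *: "computable_nat a" "computable_nat b" "computable_nat c" "computable_nat a'" "computable_nat b'" "computable_nat c'"
    and f: "\<And>x. f x = (real (a x) - real (b x)) / real (Suc (c x))"
    and g: "\<And>x. g x = (real (a' x) - real (b' x)) / real (Suc (c' x))"
    using assms by (elim computable_ratE) blast
  show ?thesis
    by (rule computable_ratI[of "\<lambda>x. a x * Suc (c' x) + a' x * Suc (c x)"
          "\<lambda>x. b x * Suc (c' x) + b' x * Suc (c x)" "\<lambda>x. Suc (c x) * Suc (c' x) - 1"])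
      (intro * computable_intros | simp add: f g divide_simps del: mult_Suc mult_Suc_right | simp add: algebra_simps)+
qed

lemma computable_rat_mult [computable_intros]:
  assumes "computable_rat f" "computable_rat g"
  shows "computable_rat (\<lambda>x. f x * g x)"
proof -
  obtain a b c a' b' c' where
    *: "computable_nat a" "computable_nat b" "computable_nat c" "computable_nat a'" "computable_nat b'" "computable_nat c'"
    and f: "\<And>x. f x = (real (a x) - real (b x)) / real (Suc (c x))"
    and g: "\<And>x. g x = (real (a' x) - real (b' x)) / real (Suc (c' x))"
    using assms by (elim computable_ratE) blast
  show ?thesis
    by (rule computable_ratI[of "\<lambda>x. a x * a' x + b x * b' x"
          "\<lambda>x. a x * b' x + b x * a' x" "\<lambda>x. Suc (c x) * Suc (c' x) - 1"])
      (intro * computable_intros | simp add: f g divide_simps del: mult_Suc mult_Suc_right | simp add: algebra_simps)+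
qed

lemma computable_rat_const [computable_intros]:
  assumes "r \<in> \<rat>"
  shows "computable_rat (\<lambda>x. r)"
proof -
  obtain i n where "n > 0" "r = of_int i / of_int n"
    using Rats_cases'[OF assms] by metis
  then have "r = (real (nat i) - real (nat (- i))) / real (Suc (nat n - 1))"
    by (cases "i \<ge> 0") auto
  then show ?thesis
    by (intro computable_ratI[of "\<lambda>x. nat i" "\<lambda>x. nat (- i)" "\<lambda>x. nat n - 1"] computable_const)
qed

lemma computable_rat_minus [computable_intros]:
  "computable_rat f \<Longrightarrow> computable_rat (\<lambda>x. - f x)"
  using computable_rat_mult[OF computable_rat_const[of "-1"]] by simp

lemma computable_rat_diff [computable_intros]:
  "computable_rat f \<Longrightarrow> computable_rat g \<Longrightarrow> computable_rat (\<lambda>x. f x - g x)"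
  using computable_rat_add[OF _ computable_rat_minus] by simp

lemma computable_rat_power2 [computable_intros]:
  "computable_rat f \<Longrightarrow> computable_rat (\<lambda>x. (f x)\<^sup>2)"
  unfolding power2_eq_square by (rule computable_rat_mult)

lemma computable_rat_divide_Suc [computable_intros]:
  assumes "computable_rat f" "computable_nat g"
  shows "computable_rat (\<lambda>x. f x / real (Suc (g x)))"
proof -
  have "computable_rat (\<lambda>x. 1 / real (Suc (g x)))"
    by (rule computable_ratI[of "\<lambda>x. 1" "\<lambda>x. 0" g]) (simp_all add: assms computable_const)
  from computable_rat_mult[OF assms(1) this] show ?thesis by simp
qed

lemma computable_rat_divide_power:
  assumes "computable_rat f" "computable_nat g" "k > 0"
  shows "computable_rat (\<lambda>x. f x / real k ^ g x)"
proof -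
  have "computable_rat (\<lambda>x. f x / real (Suc (k ^ g x - 1)))"
    by (intro assms computable_intros)
  then show ?thesis using assms(3) by simp
qed

lemma computable_rat_divide_numeral_power [computable_intros]:
  "computable_rat f \<Longrightarrow> computable_nat g \<Longrightarrow> computable_rat (\<lambda>x. f x / numeral w ^ g x)"
  using computable_rat_divide_power[of f g "numeral w"] by simp

lemma computable_rat_sum:
  "(\<And>i. i \<in> S \<Longrightarrow> computable_rat (f i)) \<Longrightarrow> computable_rat (\<lambda>x. \<Sum>i\<in>S. f i x)"
  by (induction S rule: infinite_finite_induct) (auto intro!: computable_intros)

lemma decidable_rat_less [computable_intros]:
  assumes "computable_rat f" "computable_rat g"
  shows "decidable (\<lambda>x. f x < g x)"
proof -
  obtain a b c where "computable_nat a" "computable_nat b"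
    and *: "\<And>x. g x - f x = (real (a x) - real (b x)) / real (Suc (c x))"
    using computable_rat_diff[OF assms(2,1)] by (elim computable_ratE) blast
  then have "decidable (\<lambda>x. b x < a x)" by (intro decidable_less)
  moreover have "b x < a x \<longleftrightarrow> f x < g x" for x
  proof -
    have "f x < g x \<longleftrightarrow> 0 < g x - f x" by simp
    also have "\<dots> \<longleftrightarrow> b x < a x" unfolding * by (simp add: zero_less_divide_iff)
    finally show ?thesis by simp
  qed
  ultimately show ?thesis by simp
qed

text \<open>On negative values \<open>nat\<close> gives 0, and so does the truncated numerator
  \<open>a x - b x\<close>; one integer division covers both signs.\<close>

lemma computable_nat_floor [computable_intros]:
  assumes "computable_rat f"
  shows "computable_nat (\<lambda>x. nat \<lfloor>f x\<rfloor>)"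
proof -
  obtain a b c where *: "computable_nat a" "computable_nat b" "computable_nat c"
    and f: "\<And>x. f x = (real (a x) - real (b x)) / real (Suc (c x))"
    using assms by (elim computable_ratE) blast
  have "nat \<lfloor>f x\<rfloor> = (a x - b x) div Suc (c x)" for x
  proof (cases "b x \<le> a x")
    case True
    then have "f x = real (a x - b x) / real (Suc (c x))"
      by (simp add: f of_nat_diff)
    then show ?thesis by (simp only: floor_divide_of_nat_eq nat_int)
  next
    case False
    then have "f x \<le> 0" by (simp add: f divide_nonpos_pos)
    then show ?thesis using False by simp
  qed
  moreover have "computable_nat (\<lambda>x. (a x - b x) div Suc (c x))"
    by (intro * computable_intros)
  ultimately show ?thesis by simp
qed

lemma int_decode_eq_if: "int_decode n = (if even n then int (n div 2) else - int (n div 2) - 1)"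
  by (simp add: int_decode_def sum_decode_def)

lemma computable_rat_rat_code [computable_intros]:
  assumes "computable_nat f"
  shows "computable_rat (\<lambda>x. rat_code (f x))"
proof (rule computable_ratI)
  show "computable_nat (\<lambda>x. if fst (prod_decode (f x)) mod 2 = 0 then fst (prod_decode (f x)) div 2 else 0)"
    by (intro assms computable_intros)
  show "computable_nat (\<lambda>x. if fst (prod_decode (f x)) mod 2 = 0 then 0 else Suc (fst (prod_decode (f x)) div 2))"
    by (intro assms computable_intros)
  show "computable_nat (\<lambda>x. snd (prod_decode (f x)))"
    by (intro assms computable_intros)
qed (simp add: rat_code_def int_decode_eq_if split_beta even_iff_mod_2_eq_zero)

lemma computable_rat_nnrat_code [computable_intros]:
  assumes "computable_nat f"
  shows "computable_rat (\<lambda>x. nnrat_code (f x))"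
  unfolding nnrat_code_def split_beta by (intro assms computable_intros)

lemma computable_rat_codeE:
  assumes "computable_rat f"
  obtains g where "computable_nat g" "\<And>x. rat_code (g x) = f x"
proof -
  obtain a b c where *: "computable_nat a" "computable_nat b" "computable_nat c"
    and f: "\<And>x. f x = (real (a x) - real (b x)) / real (Suc (c x))"
    using assms by (elim computable_ratE) blast
  define g where "g x = prod_encode (if b x \<le> a x then 2 * (a x - b x) else 2 * (b x - a x - 1) + 1, c x)" for x
  have "computable_nat g"
    unfolding g_def by (intro * computable_intros)
  moreover have "rat_code (g x) = f x" for x
    by (auto simp: g_def rat_code_def f int_decode_eq_if of_nat_diff not_le)
  ultimately show ?thesis using that by blast
qed

lemma computable_nnrat_codeE:
  assumes "computable_rat f" "\<And>x. f x \<ge> 0"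
  obtains g where "computable_nat g" "\<And>x. nnrat_code (g x) = f x"
proof -
  obtain a b c where *: "computable_nat a" "computable_nat b" "computable_nat c"
    and f: "\<And>x. f x = (real (a x) - real (b x)) / real (Suc (c x))"
    using assms(1) by (elim computable_ratE) blast
  have "b x \<le> a x" for x
    using assms(2)[of x] by (simp add: f zero_le_divide_iff)
  then have "nnrat_code (prod_encode (a x - b x, c x)) = f x" for x
    by (simp add: nnrat_code_def f of_nat_diff)
  moreover have "computable_nat (\<lambda>x. prod_encode (a x - b x, c x))"
    by (intro * computable_intros)
  ultimately show ?thesis using that by blast
qed

lemma nnrat_code_surj:
  assumes "r \<in> \<rat>" "r \<ge> 0"
  obtains k where "nnrat_code k = r"
  using computable_nnrat_codeE[OF computable_rat_const[OF assms(1)]] assms(2) by metis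

section \<open>Codes of rational vectors and comparison of Euclidean distances\<close>

definition enum_index :: "'n::enum \<Rightarrow> nat" where
  "enum_index i = (SOME m. m < length (enum_class.enum :: 'n list) \<and> enum_class.enum ! m = i)"

lemma length_enum: "length (enum_class.enum :: 'n::enum list) = CARD('n)"
  using distinct_card[of "enum_class.enum :: 'n list"] by (simp add: UNIV_enum enum_distinct)

lemma enum_index: "enum_index (i :: 'n::enum) < CARD('n)" "enum_class.enum ! enum_index i = i"
proof -
  have "i \<in> set enum_class.enum" by (simp add: UNIV_enum[symmetric])
  then have "\<exists>m. m < length (enum_class.enum :: 'n list) \<and> enum_class.enum ! m = i"
    by (simp add: in_set_conv_nth)
  from someI_ex[OF this]
  show "enum_index i < CARD('n)" "enum_class.enum ! enum_index i = i"
    unfolding enum_index_def[symmetric] by (simp_all add: length_enum)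
qed

text \<open>Short code lists cause no exception: \<open>code_nth\<close> pads with 0, and
  \<open>rat_code 0 = 0\<close> is the default coordinate in \<open>vec_code\<close>.\<close>

lemma vec_code_nth: "vec_code k $ (i :: 'n::enum) = rat_code (code_nth k (enum_index i))"
proof (cases "enum_index i < length (list_decode k)")
  case True
  have "distinct (map fst (zip (enum_class.enum :: 'n list) (list_decode k)))"
    by (simp add: map_fst_zip_take enum_distinct)
  moreover have "(i, list_decode k ! enum_index i) \<in> set (zip enum_class.enum (list_decode k))"
    unfolding set_zip using True enum_index[of i] by (force simp: length_enum)
  ultimately have "map_of (zip enum_class.enum (list_decode k)) i = Some (list_decode k ! enum_index i)"
    by (rule map_of_is_SomeI)
  then show ?thesis using True by (simp add: vec_code_def code_nth_eq)
next
  case False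
  have "i \<notin> fst ` set (zip enum_class.enum (list_decode k))"
  proof
    assume "i \<in> fst ` set (zip enum_class.enum (list_decode k))"
    then obtain m where m: "m < length (enum_class.enum :: 'n list)" "m < length (list_decode k)"
        "enum_class.enum ! m = i"
      by (auto simp: set_zip)
    then have "m = enum_index i"
      using enum_index[of i] enum_distinct by (metis length_enum nth_eq_iff_index_eq)
    then show False using m False by simp
  qed
  then have "map_of (zip enum_class.enum (list_decode k)) i = None"
    by (simp add: map_of_eq_None_iff)
  moreover have "rat_code 0 = 0"
    by (simp add: rat_code_def int_decode_eq_if)
  ultimately show ?thesis using False by (simp add: vec_code_def code_nth_eq)
qed

definition computable_vec :: "(nat \<Rightarrow> real ^ 'n) \<Rightarrow> bool" where
  "computable_vec v \<longleftrightarrow> (\<forall>i. computable_rat (\<lambda>x. v x $ i))"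

lemma computable_vec_vec_code [computable_intros]:
  "computable_nat f \<Longrightarrow> computable_vec (\<lambda>x. vec_code (f x))"
  unfolding computable_vec_def vec_code_nth by (intro allI computable_intros)

lemma computable_list_encode_map:
  "(\<And>i. i \<in> set is \<Longrightarrow> computable_nat (c i)) \<Longrightarrow> computable_nat (\<lambda>x. list_encode (map (\<lambda>i. c i x) is))"
  by (induction "is") (auto intro!: computable_intros)

lemma computable_vec_codeE:
  fixes v :: "nat \<Rightarrow> real ^ 'n::enum"
  assumes "computable_vec v"
  obtains g where "computable_nat g" "\<And>x. vec_code (g x) = v x"
proof -
  have "\<exists>c. computable_nat c \<and> (\<forall>x. rat_code (c x) = v x $ i)" for i
    using assms computable_rat_codeE[of "\<lambda>x. v x $ i"] unfolding computable_vec_def by blast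
  then obtain c where c: "\<And>i. computable_nat (c i)" "\<And>i x. rat_code (c i x) = v x $ i"
    by metis
  define g where "g x = list_encode (map (\<lambda>i. c i x) enum_class.enum)" for x
  have "computable_nat g"
    unfolding g_def by (intro computable_list_encode_map c)
  moreover have "vec_code (g x) = v x" for x
    by (simp add: vec_eq_iff vec_code_nth g_def code_nth_eq length_enum enum_index c)
  ultimately show ?thesis using that by blast
qed

lemma vec_code_surj:
  fixes v :: "real ^ 'n::enum"
  assumes "\<And>i. v $ i \<in> \<rat>"
  obtains k where "vec_code k = v"
proof -
  have "computable_vec (\<lambda>x. v)"
    unfolding computable_vec_def using assms by (intro allI computable_intros)
  then show ?thesis
    using computable_vec_codeE that by metis
qed

lemma vec_code_dense:
  fixes v :: "real ^ 'n::enum"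
  assumes "e > 0"
  obtains k where "dist (vec_code k) v < e"
proof -
  have "\<exists>r\<in>\<rat>. v $ i < r \<and> r < v $ i + e / real CARD('n)" for i
    using assms by (intro Rats_dense_in_real) simp
  then obtain r where r: "\<And>i. r i \<in> \<rat>" "\<And>i. v $ i < r i" "\<And>i. r i < v $ i + e / real CARD('n)"
    by metis
  obtain k where k: "vec_code k = (\<chi> i. r i)"
    using vec_code_surj[of "\<chi> i. r i"] r(1) by auto
  have "norm (vec_code k - v) \<le> (\<Sum>i\<in>UNIV. \<bar>(vec_code k - v) $ i\<bar>)"
    by (rule norm_le_l1_cart)
  also have "\<dots> < (\<Sum>i\<in>(UNIV :: 'n set). e / real CARD('n))"
  proof (intro sum_strict_mono)
    show "\<bar>(vec_code k - v) $ i\<bar> < e / real CARD('n)" for i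
      using r(2,3)[of i] by (simp add: k)
  qed auto
  also have "\<dots> = e" by simp
  finally show ?thesis using that by (simp add: dist_norm)
qed

lemma dist_vec_power2:
  fixes u w :: "real ^ 'n"
  shows "(dist u w)\<^sup>2 = (\<Sum>i\<in>UNIV. (u $ i - w $ i)\<^sup>2)"
  by (simp add: dist_vec_def L2_set_def sum_nonneg dist_real_def)

lemma computable_rat_dist_power2:
  assumes "computable_vec u" "computable_vec w"
  shows "computable_rat (\<lambda>x. (dist (u x) (w x))\<^sup>2)"
  unfolding dist_vec_power2 using assms unfolding computable_vec_def
  by (intro computable_rat_sum computable_intros) auto

text \<open>The distance of rational vectors need not be rational, but its square is. Comparison is
  done on squares, after the sign of \<open>r x\<close> has been settled.\<close>

lemma decidable_dist_less [computable_intros]: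
  assumes "computable_vec u" "computable_vec w" "computable_rat r"
  shows "decidable (\<lambda>x. dist (u x) (w x) < r x)"
proof -
  have "decidable (\<lambda>x. 0 < r x \<and> (dist (u x) (w x))\<^sup>2 < (r x)\<^sup>2)"
    by (intro assms computable_intros computable_rat_dist_power2) simp
  moreover have "0 < r x \<and> (dist (u x) (w x))\<^sup>2 < (r x)\<^sup>2 \<longleftrightarrow> dist (u x) (w x) < r x" for x
    using power2_less_imp_less[of "dist (u x) (w x)" "r x"]
      power_strict_mono[of "dist (u x) (w x)" "r x" 2] le_less_trans[OF zero_le_dist]
    by auto
  ultimately show ?thesis by simp
qed

lemma decidable_less_dist [computable_intros]:
  assumes "computable_vec u" "computable_vec w" "computable_rat r"
  shows "decidable (\<lambda>x. r x < dist (u x) (w x))"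
proof -
  have "decidable (\<lambda>x. r x < 0 \<or> (r x)\<^sup>2 < (dist (u x) (w x))\<^sup>2)"
    by (intro assms computable_intros computable_rat_dist_power2) simp
  moreover have "r x < 0 \<or> (r x)\<^sup>2 < (dist (u x) (w x))\<^sup>2 \<longleftrightarrow> r x < dist (u x) (w x)" for x
    using power2_less_imp_less[of "r x" "dist (u x) (w x)"]
      power_strict_mono[of "r x" "dist (u x) (w x)" 2] less_le_trans[OF _ zero_le_dist, of "r x"]
    by force
  ultimately show ?thesis by simp
qed

lemma computable_rat_if [computable_intros]:
  assumes "decidable P" "computable_rat f" "computable_rat g"
  shows "computable_rat (\<lambda>x. if P x then f x else g x)"
proof -
  obtain a b c a' b' c' where
    *: "computable_nat a" "computable_nat b" "computable_nat c" "computable_nat a'" "computable_nat b'" "computable_nat c'"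
    and f: "\<And>x. f x = (real (a x) - real (b x)) / real (Suc (c x))"
    and g: "\<And>x. g x = (real (a' x) - real (b' x)) / real (Suc (c' x))"
    using assms(2,3) by (elim computable_ratE) blast
  show ?thesis
  proof (rule computable_ratI)
    show "computable_nat (\<lambda>x. if P x then a x else a' x)" "computable_nat (\<lambda>x. if P x then b x else b' x)"
      "computable_nat (\<lambda>x. if P x then c x else c' x)"
      by (intro * assms(1) computable_intros)+
  qed (simp add: f g)
qed

lemma computable_rat_of_nat_power [computable_intros]:
  assumes "computable_nat g"
  shows "computable_rat (\<lambda>x. real k ^ g x)"
proof -
  have "computable_rat (\<lambda>x. real (k ^ g x))"
    by (intro assms computable_intros)
  then show ?thesis by simp
qed

lemma decidable_comp: "decidable P \<Longrightarrow> computable_nat f \<Longrightarrow> decidable (\<lambda>x. P (f x))"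
  unfolding decidable_def by (rule computable_comp)

section \<open>Represented spaces\<close>

lemma cauchy_rep_SomeI:
  assumes "\<And>i j. i \<le> j \<Longrightarrow> dist (\<alpha> (p i)) (\<alpha> (p j)) \<le> (1/2) ^ i" and "(\<lambda>i. \<alpha> (p i)) \<longlonglongrightarrow> x"
  shows "cauchy_rep \<alpha> p = Some x"
  using assms limI unfolding cauchy_rep_def by auto

text \<open>\<open>cauchy_rep\<close> merely applies \<open>lim\<close>, which is meaningful only
  for convergent sequences; completeness of the space supplies the convergence.\<close>

lemma cauchy_rep_SomeD:
  fixes \<alpha> :: "nat \<Rightarrow> 'a::complete_space"
  assumes "cauchy_rep \<alpha> p = Some x"
  shows "i \<le> j \<Longrightarrow> dist (\<alpha> (p i)) (\<alpha> (p j)) \<le> (1/2) ^ i"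
    and "(\<lambda>i. \<alpha> (p i)) \<longlonglongrightarrow> x"
    and "dist (\<alpha> (p i)) x \<le> (1/2) ^ i"
proof -
  have bound: "\<And>i j. i \<le> j \<Longrightarrow> dist (\<alpha> (p i)) (\<alpha> (p j)) \<le> (1/2) ^ i" and x: "x = lim (\<lambda>i. \<alpha> (p i))"
    using assms unfolding cauchy_rep_def by (auto split: if_splits)
  then show "i \<le> j \<Longrightarrow> dist (\<alpha> (p i)) (\<alpha> (p j)) \<le> (1/2) ^ i" by blast
  have "Cauchy (\<lambda>i. \<alpha> (p i))"
  proof (rule metric_CauchyI)
    fix e :: real assume "e > 0"
    then obtain M where M: "(1/2) ^ M < e / 2"
      using real_arch_pow_inv[of "e/2" "1/2"] by auto
    have "dist (\<alpha> (p m)) (\<alpha> (p n)) < e" if "M \<le> m" "M \<le> n" for m n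
      using bound[OF that(1)] bound[OF that(2)] dist_triangle3[of "\<alpha> (p m)" "\<alpha> (p n)" "\<alpha> (p M)"] M by simp
    then show "\<exists>M. \<forall>m\<ge>M. \<forall>n\<ge>M. dist (\<alpha> (p m)) (\<alpha> (p n)) < e" by blast
  qed
  then show lim: "(\<lambda>i. \<alpha> (p i)) \<longlonglongrightarrow> x"
    unfolding x by (simp add: Cauchy_convergent_iff convergent_LIMSEQ_iff)
  show "dist (\<alpha> (p i)) x \<le> (1/2) ^ i"
    by (rule LIMSEQ_le_const2[OF tendsto_dist[OF tendsto_const lim]]) (use bound in blast)
qed

lemma neg_rep_closed: "neg_rep \<alpha> p = Some A \<Longrightarrow> closed A"
  unfolding neg_rep_def by (auto intro: closed_Compl)

text \<open>A closed set in a Heine-Borel space has a nearest point, so the domain of the projection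
  consists exactly of the inputs with nonempty set.\<close>

lemma eps_proj_nonempty_iff:
  fixes A :: "'a::heine_borel set"
  assumes "closed A" "\<epsilon> \<ge> 0"
  shows "eps_proj \<epsilon> (x, A) \<noteq> {} \<longleftrightarrow> A \<noteq> {}"
proof
  assume "A \<noteq> {}"
  then obtain y where "y \<in> A" "infdist x A = dist x y"
    using infdist_attains_inf[OF assms(1)] by blast
  moreover from this have "dist x y \<le> (1 + \<epsilon>) * infdist x A"
    using assms(2) by (simp add: mult_le_cancel_right2 algebra_simps)
  ultimately show "eps_proj \<epsilon> (x, A) \<noteq> {}"
    unfolding eps_proj_def by auto
qed (auto simp: eps_proj_def)

text \<open>A realizer \<open>G\<close> may return any name of any admissible value, so the
  condition on \<open>H\<close> quantifies over all of these; \<open>G\<close> then disappears from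
  the problem.\<close>

lemma sW_leI:
  assumes "computable_pf (\<lambda>p. Some (H p))" "computable_pf (\<lambda>p. Some (K p))"
    and "\<And>p x. \<delta>X p = Some x \<Longrightarrow> f x \<noteq> {} \<Longrightarrow>
           \<exists>z. \<delta>Z (K p) = Some z \<and> g z \<noteq> {} \<and>
             (\<forall>q w. \<delta>W q = Some w \<longrightarrow> w \<in> g z \<longrightarrow> (\<exists>y. \<delta>Y (H q) = Some y \<and> y \<in> f x))"
  shows "sW_le f \<delta>X \<delta>Y g \<delta>Z \<delta>W"
  unfolding sW_le_def
proof (intro exI conjI allI impI)
  show "computable_pf (\<lambda>p. Some (H p))" "computable_pf (\<lambda>p. Some (K p))"
    by fact+
  fix G
  assume G: "realizes \<delta>Z \<delta>W g G"
  show "realizes \<delta>X \<delta>Y f (\<lambda>p. Option.bind (Some (K p)) (\<lambda>r. Option.bind (G r) (\<lambda>p. Some (H p))))"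
    unfolding realizes_def
  proof (intro allI impI)
    fix p x
    assume "\<delta>X p = Some x" "f x \<noteq> {}"
    then obtain z where z: "\<delta>Z (K p) = Some z" "g z \<noteq> {}"
      and H: "\<And>q w. \<delta>W q = Some w \<Longrightarrow> w \<in> g z \<Longrightarrow> \<exists>y. \<delta>Y (H q) = Some y \<and> y \<in> f x"
      using assms(3) by meson
    obtain q w where "G (K p) = Some q" "\<delta>W q = Some w" "w \<in> g z"
      using G z unfolding realizes_def by blast
    then show "\<exists>q y. Option.bind (Some (K p)) (\<lambda>r. Option.bind (G r) (\<lambda>p. Some (H p))) = Some q
        \<and> \<delta>Y q = Some y \<and> y \<in> f x"
      using H by auto
  qed
qed

section \<open>Closed choice reduces to approximate projection\<close>

lemma code_nth_Cons:
  "code_nth (Suc (prod_encode (c, z))) 0 = c"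
  "code_nth (Suc (prod_encode (c, z))) (Suc m) = code_nth z m"
  "code_nth (code_tl k) m = code_nth k (Suc m)"
  by (simp_all add: code_nth_def code_tl_def funpow_Suc_right del: funpow.simps(2))

lemma vec_code_Cons:
  fixes i0 :: "'n::enum"
  assumes "enum_index i0 = 0"
  shows "vec_code (Suc (prod_encode (c, code_tl k))) $ i
    = (if i = i0 then rat_code c else vec_code k $ i)"
proof (cases "enum_index i")
  case 0
  then have "i = i0" using enum_index(2)[of i] enum_index(2)[of i0] assms by simp
  then show ?thesis using 0 by (simp add: vec_code_nth code_nth_Cons)
next
  case (Suc m)
  then have "i \<noteq> i0" using assms by auto
  then show ?thesis using Suc by (simp add: vec_code_nth code_nth_Cons)
qed

text \<open>A slab is not a basic ball, but it is the union of balls of its own half-width centred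
  on its middle hyperplane. Fixing the head \<open>c\<close> of the code and letting the tail
  \<open>z\<close> vary runs through the rational points of that hyperplane.\<close>

lemma cylinder_eq_Union_balls:
  fixes i0 :: "'n::enum"
  assumes i0: "enum_index i0 = 0"
  shows "{v :: real ^ 'n::enum. v $ i0 \<in> ball (rat_code c) r}
    = (\<Union>z. ball (vec_code (Suc (prod_encode (c, z)))) r)"
proof (intro equalityI subsetI)
  fix v :: "real ^ 'n::enum"
  assume "v \<in> {v. v $ i0 \<in> ball (rat_code c) r}"
  then have d: "dist (rat_code c) (v $ i0) < r" by simp
  \<comment> \<open>The orthogonal projection of \<open>v\<close> onto the hyperplane; its distance
    to \<open>v\<close> is the difference in coordinate \<open>i0\<close> alone.\<close>
  define w where "w = (\<chi> i. if i = i0 then rat_code c else v $ i)"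
  have "norm (w - v) \<le> (\<Sum>i\<in>UNIV. \<bar>(w - v) $ i\<bar>)"
    by (rule norm_le_l1_cart)
  also have "\<dots> = (\<Sum>i\<in>UNIV. if i = i0 then \<bar>rat_code c - v $ i0\<bar> else 0)"
    by (intro sum.cong) (auto simp: w_def)
  finally have "dist w v \<le> dist (rat_code c) (v $ i0)"
    by (simp add: dist_norm)
  with d have wv: "dist w v < r" by simp
  then obtain k where k: "dist (vec_code k) w < r - dist w v"
    using vec_code_dense[of "r - dist w v" w] by auto
  \<comment> \<open>Overwriting the head of \<open>k\<close> by \<open>c\<close> puts the
    approximation exactly on the hyperplane, and brings no coordinate further from
    \<open>w\<close>.\<close>
  let ?u = "vec_code (Suc (prod_encode (c, code_tl k))) :: real ^ 'n::enum"
  have "norm (?u - w) \<le> norm (vec_code k - w)"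
    by (rule norm_le_componentwise_cart) (simp add: vec_code_Cons[OF i0] w_def)
  then have "dist ?u w < r - dist w v"
    using k by (simp add: dist_norm)
  then have "dist ?u v < r"
    using dist_triangle[of ?u v w] by simp
  then show "v \<in> (\<Union>z. ball (vec_code (Suc (prod_encode (c, z)))) r)"
    by auto
next
  fix v :: "real ^ 'n::enum"
  assume "v \<in> (\<Union>z. ball (vec_code (Suc (prod_encode (c, z)))) r)"
  then obtain z where z: "dist (vec_code (Suc (prod_encode (c, z)))) v < r" by auto
  have "vec_code (Suc (prod_encode (c, z))) $ i0 = rat_code c"
    by (simp add: vec_code_nth i0 code_nth_Cons)
  then have "dist (rat_code c) (v $ i0) < r"
    using dist_vec_nth_le[of "vec_code (Suc (prod_encode (c, z)))" i0 v] z by simp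
  then show "v \<in> {v. v $ i0 \<in> ball (rat_code c) r}" by simp
qed

lemma closed_choice_le_eps_proj:
  assumes "\<epsilon> \<ge> 0"
  shows "sW_le closed_choice (neg_rep rat_code) (cauchy_rep rat_code)
     (eps_proj \<epsilon>)
     (pair_rep (cauchy_rep (vec_code :: nat \<Rightarrow> real ^ 'n::enum)) (neg_rep (vec_code :: nat \<Rightarrow> real ^ 'n::enum)))
     (cauchy_rep (vec_code :: nat \<Rightarrow> real ^ 'n::enum))"
proof -
  \<comment> \<open>Even positions name the origin, which has code 0. At odd positions
    \<open>k div 2\<close> is read as a pair: the index of a ball removed from \<open>A\<close> and
    the tail of a centre on the corresponding hyperplane. \<open>H\<close> returns the head of a
    vector code, which is coordinate \<open>i0\<close>, the one of index 0.\<close>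
  define K :: "baire \<Rightarrow> baire" where
    "K p k = (if k mod 2 = 0 then 0
       else prod_encode (Suc (prod_encode (fst (prod_decode (p (fst (prod_decode (k div 2))))), snd (prod_decode (k div 2)))),
              snd (prod_decode (p (fst (prod_decode (k div 2)))))))" for p k
  define H :: "baire \<Rightarrow> baire" where "H q k = code_nth (q k) 0" for q k
  define i0 :: 'n where "i0 = enum_class.enum ! 0"
  have i0: "enum_index i0 = 0"
    using enum_index[of i0] enum_distinct unfolding i0_def
    by (metis length_enum nth_eq_iff_index_eq zero_less_card_finite)
  have "computable_pf (\<lambda>q. Some (H q))"
    by (rule computable_pfI[where c = 1]) (auto simp: H_def intro!: computable_intros)
  moreover have "computable_pf (\<lambda>p. Some (K p))"
  proof (rule computable_pfI[where c = 1])
    show "computable_nat (\<lambda>t. K (code_nth (fst (prod_decode t))) (snd (prod_decode t)))"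
      unfolding K_def by (intro computable_intros)
    fix p p' :: baire and k
    assume eq: "\<And>i. i < 1 * Suc k \<Longrightarrow> p i = p' i"
    have "fst (prod_decode (k div 2)) \<le> k"
      using le_prod_encode_1[of "fst (prod_decode (k div 2))" "snd (prod_decode (k div 2))"] by simp
    then show "K p k = K p' k"
      unfolding K_def by (simp add: eq)
  qed simp
  moreover have "\<exists>z. pair_rep (cauchy_rep vec_code) (neg_rep vec_code) (K p) = Some z \<and> eps_proj \<epsilon> z \<noteq> {} \<and>
      (\<forall>q w. cauchy_rep vec_code q = Some (w :: real ^ 'n::enum) \<longrightarrow> w \<in> eps_proj \<epsilon> z \<longrightarrow>
         (\<exists>y. cauchy_rep rat_code (H q) = Some y \<and> y \<in> closed_choice A))"
    if A: "neg_rep rat_code p = Some A" "closed_choice A \<noteq> {}" for p and A :: "real set"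
  proof -
    define A' where "A' = {v :: real ^ 'n::enum. v $ i0 \<in> A}"
    have "cauchy_rep (vec_code :: nat \<Rightarrow> real ^ 'n::enum) (\<lambda>i. K p (2 * i)) = Some (vec_code 0)"
      by (rule cauchy_rep_SomeI) (auto simp: K_def)
    moreover have neg: "neg_rep (vec_code :: nat \<Rightarrow> real ^ 'n::enum) (\<lambda>i. K p (2 * i + 1)) = Some A'"
    proof -
      have K: "K p (2 * t + 1) = prod_encode (Suc (prod_encode (fst (prod_decode (p (fst (prod_decode t)))), snd (prod_decode t))),
              snd (prod_decode (p (fst (prod_decode t)))))" for t
        by (simp add: K_def)
      have "- A' = (\<Union>i. {v :: real ^ 'n::enum. v $ i0 \<in> ball (rat_code (fst (prod_decode (p i)))) (nnrat_code (snd (prod_decode (p i))))})"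
        using A(1) unfolding A'_def neg_rep_def by auto
      also have "\<dots> = (\<Union>i. \<Union>z. ball (vec_code (Suc (prod_encode (fst (prod_decode (p i)), z)))) (nnrat_code (snd (prod_decode (p i)))))"
        unfolding cylinder_eq_Union_balls[OF i0] ..
      also have "\<dots> = (\<Union>t. ball (vec_code (Suc (prod_encode (fst (prod_decode (p (fst (prod_decode t)))), snd (prod_decode t)))))
           (nnrat_code (snd (prod_decode (p (fst (prod_decode t)))))))" (is "?L = ?R")
      proof (intro equalityI subsetI)
        fix v assume "v \<in> ?L"
        then obtain i z where "v \<in> ball (vec_code (Suc (prod_encode (fst (prod_decode (p i)), z)))) (nnrat_code (snd (prod_decode (p i))))"
          by blast
        then show "v \<in> ?R"
          by (intro UN_I[of "prod_encode (i, z)"]) simp_all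
      qed blast
      finally show ?thesis
        unfolding neg_rep_def K by (auto simp: Compl_eq_Diff_UNIV)
    qed
    ultimately have "pair_rep (cauchy_rep vec_code) (neg_rep vec_code) (K p) = Some (vec_code 0 :: real ^ 'n::enum, A')"
      unfolding pair_rep_def by simp
    moreover obtain a where "a \<in> A" using A(2) unfolding closed_choice_def by blast
    then have "(\<chi> i. a) \<in> A'" unfolding A'_def by simp
    then have "eps_proj \<epsilon> (vec_code 0, A') \<noteq> {}"
      using eps_proj_nonempty_iff[OF neg_rep_closed[OF neg] assms] by blast
    moreover have "cauchy_rep rat_code (H q) = Some (w $ i0) \<and> w $ i0 \<in> closed_choice A"
      if q: "cauchy_rep vec_code q = Some w" and w: "w \<in> eps_proj \<epsilon> (vec_code 0, A')" for q and w :: "real ^ 'n::enum"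
    proof
      have H: "rat_code (H q i) = vec_code (q i) $ i0" for i
        by (simp add: H_def vec_code_nth i0)
      show "cauchy_rep rat_code (H q) = Some (w $ i0)"
      proof (rule cauchy_rep_SomeI)
        show "dist (rat_code (H q i)) (rat_code (H q j)) \<le> (1/2) ^ i" if "i \<le> j" for i j
          unfolding H by (rule order_trans[OF dist_vec_nth_le cauchy_rep_SomeD(1)[OF q that]])
        show "(\<lambda>i. rat_code (H q i)) \<longlonglongrightarrow> w $ i0"
          unfolding H by (rule tendsto_vec_nth[OF cauchy_rep_SomeD(2)[OF q]])
      qed
      show "w $ i0 \<in> closed_choice A"
        using w unfolding eps_proj_def A'_def closed_choice_def by (auto split: if_splits)
    qed
    ultimately show ?thesis by blast
  qed
  ultimately show ?thesis
    by (rule sW_leI)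
qed

section \<open>Expansions with gaps\<close>

text \<open>Dropping the last base-\<open>b\<close> digit is integer division by \<open>b\<close>,
  so the floors at all levels are the prefixes of one expansion.\<close>

lemma nat_floor_power_Suc_div:
  assumes "b > 0"
  shows "nat \<lfloor>real b ^ Suc l * z\<rfloor> div b = nat \<lfloor>real b ^ l * z\<rfloor>"
proof -
  have "\<lfloor>real b ^ l * z\<rfloor> = \<lfloor>real b ^ Suc l * z / real_of_int (int b)\<rfloor>"
    using assms by simp
  also have "\<dots> = \<lfloor>real b ^ Suc l * z\<rfloor> div int b"
    by (rule floor_divide_real_eq_div) simp
  finally show ?thesis
    by (simp only: nat_div_distrib' nat_int of_nat_0_le_iff)
qed

text \<open>A closed Cantor-like set. Level \<open>l = 0\<close> is included, so that the integer
  part, which carries the guess, is protected by a gap as well.\<close>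

definition gap_set :: "nat \<Rightarrow> real set" where
  "gap_set b = {z. 0 \<le> z \<and> (\<forall>l. frac (real b ^ l * z) \<le> 1/3)}"

text \<open>The intervals from \<open>I l\<close> to \<open>I l + 1/3\<close>, scaled by
  \<open>b ^ l\<close>, are nested: the right ends decrease because
  \<open>d l + 1/3 <= b / 3\<close>, which is the bound on \<open>d\<close>. The real sought is the
  supremum of the left ends.\<close>

lemma gap_set_expansion:
  assumes "b > 0" and step: "\<And>l. I (Suc l) = b * I l + d l" "\<And>l. 3 * d l + 1 \<le> b"
  obtains z where "z \<in> gap_set b" "\<And>l. nat \<lfloor>real b ^ l * z\<rfloor> = I l"
proof -
  define lo hi where "lo l = real (I l) / real b ^ l" and "hi l = (real (I l) + 1/3) / real b ^ l" for l
  have pos: "real b ^ l > 0" for l using assms(1) by simp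
  have "incseq lo"
  proof (rule incseq_SucI)
    show "lo l \<le> lo (Suc l)" for l
      using assms(1) pos[of l] by (simp add: lo_def step(1) field_simps)
  qed
  moreover have "decseq hi"
  proof (rule decseq_SucI)
    fix l
    have "real (I (Suc l)) + 1/3 \<le> real b * (real (I l) + 1/3)"
      using step(2)[of l] unfolding step(1) by (simp add: algebra_simps)
    then have "hi (Suc l) \<le> real b * (real (I l) + 1/3) / real b ^ Suc l"
      unfolding hi_def using pos[of "Suc l"] by (intro divide_right_mono) auto
    also have "\<dots> = hi l"
      using assms(1) by (simp add: hi_def)
    finally show "hi (Suc l) \<le> hi l" .
  qed
  moreover have "lo l \<le> hi l" for l
    using pos[of l] by (simp add: lo_def hi_def divide_right_mono)
  ultimately have lohi: "lo l \<le> hi m" for l m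
    using incseqD[of lo l "max l m"] decseqD[of hi m "max l m"] order_trans by fastforce
  define z where "z = (SUP l. lo l)"
  have "bdd_above (range lo)"
    using lohi[of _ 0] by (intro bdd_aboveI[of _ "hi 0"]) auto
  then have z1: "lo l \<le> z" for l
    unfolding z_def by (rule cSUP_upper[OF UNIV_I])
  have z2: "z \<le> hi l" for l
    unfolding z_def using lohi by (intro cSUP_least) auto
  have bounds: "real (I l) \<le> real b ^ l * z" "real b ^ l * z \<le> real (I l) + 1/3" for l
    using z1[of l] z2[of l] pos[of l] by (simp_all add: lo_def hi_def field_simps)
  have fl: "\<lfloor>real b ^ l * z\<rfloor> = int (I l)" for l
    using bounds[of l] by (intro floor_unique) auto
  have "0 \<le> z"
    using bounds(1)[of 0] order_trans[OF of_nat_0_le_iff] by simp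
  moreover have "frac (real b ^ l * z) \<le> 1/3" for l
    using bounds(2)[of l] by (simp add: frac_def fl)
  ultimately have "z \<in> gap_set b"
    unfolding gap_set_def by blast
  then show ?thesis using that fl by simp
qed

text \<open>With \<open>k\<close> the floor of the exact value, the approximate value lies between
  \<open>k - 1/4\<close> and \<open>k + 1/3 + 1/4\<close>. Adding 1/3 moves it between
  \<open>k + 1/12\<close> and \<open>k + 11/12\<close>, away from both integers.\<close>

lemma gap_set_floor_approx:
  assumes "z \<in> gap_set b" "real b ^ l * \<bar>z' - z\<bar> \<le> 1/4"
  shows "nat \<lfloor>real b ^ l * z' + 1/3\<rfloor> = nat \<lfloor>real b ^ l * z\<rfloor>"
proof -
  have "frac (real b ^ l * z) \<le> 1/3"
    using assms(1) unfolding gap_set_def by auto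
  then have "of_int \<lfloor>real b ^ l * z\<rfloor> \<le> real b ^ l * z" "real b ^ l * z \<le> of_int \<lfloor>real b ^ l * z\<rfloor> + 1/3"
    by (simp_all add: frac_def)
  moreover have "\<bar>real b ^ l * z' - real b ^ l * z\<bar> \<le> 1/4"
    using assms(2) by (simp add: right_diff_distrib[symmetric] abs_mult)
  ultimately have "\<lfloor>real b ^ l * z' + 1/3\<rfloor> = \<lfloor>real b ^ l * z\<rfloor>"
    by (intro floor_unique) linarith+
  then show ?thesis by simp
qed

section \<open>Coding points of Euclidean space by real numbers\<close>

text \<open>A digit holds one bit for each of \<open>n\<close> coordinates and is thus below
  \<open>2 ^ n\<close>; then \<open>3 * d + 1 <= 2 ^ (n + 2)\<close>, as the gaps demand. A power of
  two keeps the bits of a digit aligned and the required precision of names exact.\<close>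

definition radix :: "nat \<Rightarrow> nat" where
  "radix n = 2 ^ (n + 2)"

lemma radix_pos [simp]: "radix n > 0"
  by (simp add: radix_def)

text \<open>Undoes the interleaving of coordinates: bit \<open>m\<close> of each of the last
  \<open>L\<close> digits of \<open>I\<close>, reassembled into one binary number, with the last
  digit least significant.\<close>

definition digit_sum :: "nat \<Rightarrow> nat \<Rightarrow> nat \<Rightarrow> nat \<Rightarrow> nat" where
  "digit_sum n m L I = (\<Sum>l<L. (I div radix n ^ l div 2 ^ m mod 2) * 2 ^ l)"

lemma digit_sum_Suc:
  "digit_sum n m (Suc L) I = I div 2 ^ m mod 2 + 2 * digit_sum n m L (I div radix n)"
  unfolding digit_sum_def sum.lessThan_Suc_shift
  by (simp add: div_mult2_eq sum_distrib_left mult_ac)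

definition guess_radius :: "nat \<Rightarrow> real" where
  "guess_radius j = nnrat_code (fst (prod_decode j))"

definition guess_count :: "nat \<Rightarrow> nat" where
  "guess_count j = fst (prod_decode (snd (prod_decode j)))"

definition guess_origin :: "nat \<Rightarrow> real ^ 'n::enum" where
  "guess_origin j = vec_code (snd (prod_decode (snd (prod_decode j))))"

text \<open>The lower corner of a dyadic cell of side \<open>1 / 2 ^ L\<close>. What remains of
  \<open>I\<close> after removing its last \<open>L\<close> digits is the integer part of the coding
  real, hence the guess and its origin.\<close>

definition cell_vec :: "nat \<Rightarrow> nat \<Rightarrow> real ^ 'n::enum" where
  "cell_vec L I = (\<chi> i. guess_origin (I div radix CARD('n) ^ L) $ i
     + real (digit_sum CARD('n) (enum_index i) L I) / 2 ^ L)"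

lemma computable_digit_sum [computable_intros]:
  assumes "computable_nat f" "computable_nat g"
  shows "computable_nat (\<lambda>x. digit_sum n m (f x) (g x))"
  unfolding digit_sum_def
  by (intro computable_sum computable_mult computable_mod computable_div computable_comp[OF assms(2)]
      assms computable_intros)

lemma computable_cell_vec [computable_intros]:
  assumes "computable_nat f" "computable_nat g"
  shows "computable_vec (\<lambda>x. cell_vec (f x) (g x))"
  unfolding computable_vec_def cell_vec_def guess_origin_def vec_code_nth vec_lambda_beta
  by (intro allI assms computable_intros)

lemma expansion_div:
  assumes "\<And>l. I (Suc l) div b = I l"
  shows "I L div b ^ L = (I 0 :: nat)"
  by (induction L) (simp_all add: div_mult2_eq assms)

lemma dist_le_of_components:
  fixes u v :: "real ^ 'n"
  assumes "\<And>i. \<bar>u $ i - v $ i\<bar> \<le> e"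
  shows "dist u v \<le> real CARD('n) * e"
proof -
  have "norm (u - v) \<le> (\<Sum>i\<in>UNIV. \<bar>(u - v) $ i\<bar>)"
    by (rule norm_le_l1_cart)
  also have "\<dots> \<le> (\<Sum>i\<in>(UNIV :: 'n set). e)"
    using assms by (intro sum_mono) simp
  finally show ?thesis by (simp add: dist_norm)
qed

lemma cell_vec_dist:
  assumes I: "\<And>l. I (Suc l) div radix CARD('n::enum) = I l" and "L \<le> L'"
  shows "dist (cell_vec L (I L) :: real ^ 'n::enum) (cell_vec L' (I L')) \<le> real CARD('n) / 2 ^ L"
proof -
  define a where "a i l = real (digit_sum CARD('n) (enum_index i) l (I l)) / 2 ^ l" for i :: 'n and l
  have a_Suc: "a i (Suc l) = a i l + real (I (Suc l) div 2 ^ enum_index i mod 2) / 2 ^ Suc l" for i l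
    by (simp add: a_def digit_sum_Suc I field_simps)
  \<comment> \<open>The upper bound carries the exact partial geometric sum, since the bare bound
    \<open>1 / 2 ^ L\<close> would not survive the induction step.\<close>
  have "a i L \<le> a i L' \<and> a i L' \<le> a i L + (1 / 2 ^ L - 1 / 2 ^ L')" for i
    using \<open>L \<le> L'\<close>
  proof (induction L' rule: dec_induct)
    case (step l)
    have "real (I (Suc l) div 2 ^ enum_index i mod 2) / 2 ^ Suc l \<le> 1 / 2 ^ Suc l"
      by (intro divide_right_mono) auto
    moreover have "0 \<le> real (I (Suc l) div 2 ^ enum_index i mod 2) / 2 ^ Suc l" by simp
    moreover have "1 / 2 ^ l = 1 / 2 ^ Suc l + 1 / (2 ^ Suc l :: real)" by simp
    ultimately show ?case
      using step.IH a_Suc[of i l] by linarith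
  qed simp
  moreover have "(0::real) \<le> 1 / 2 ^ L'" by simp
  ultimately have "\<bar>a i L - a i L'\<bar> \<le> 1 / 2 ^ L" for i
    by (smt (verit))
  then have "\<bar>(cell_vec L (I L) :: real ^ 'n::enum) $ i - cell_vec L' (I L') $ i\<bar> \<le> 1 / 2 ^ L" for i
    by (simp add: cell_vec_def expansion_div[of I, OF I] a_def)
  from dist_le_of_components[OF this] show ?thesis by simp
qed

text \<open>\<open>digit_sum\<close> is used only for the bits belonging to coordinates, so the
  digits need not be below \<open>2 ^ CARD('n)\<close>: any expansion whatever codes a
  vector.\<close>

lemma cell_vec_limit:
  assumes I: "\<And>l. I (Suc l) div radix CARD('n::enum) = I l"
  obtains y :: "real ^ 'n::enum"
  where "\<And>L. dist (cell_vec L (I L)) y \<le> real CARD('n) / 2 ^ L"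
    "(\<lambda>L. cell_vec L (I L)) \<longlonglongrightarrow> y"
proof -
  define Y where "Y L = (cell_vec L (I L) :: real ^ 'n::enum)" for L
  have bound: "dist (Y L) (Y L') \<le> real CARD('n) / 2 ^ L" if "L \<le> L'" for L L'
    unfolding Y_def by (rule cell_vec_dist[of I, OF I that])
  have small: "(\<lambda>L. real CARD('n) / 2 ^ L) \<longlonglongrightarrow> 0"
    using tendsto_mult_right_zero[OF LIMSEQ_power_zero[of "1/2 :: real"], of "real CARD('n)"]
    by (simp add: power_divide)
  have "Cauchy Y"
  proof (rule metric_CauchyI)
    fix e :: real assume "e > 0"
    then obtain M where M: "real CARD('n) / 2 ^ M < e / 2"
      using order_tendstoD(2)[OF small, of "e/2"] unfolding eventually_sequentially by auto
    have "dist (Y m) (Y n) < e" if "M \<le> m" "M \<le> n" for m n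
      using bound[OF that(1)] bound[OF that(2)] dist_triangle3[of "Y m" "Y n" "Y M"] M by linarith
    then show "\<exists>M. \<forall>m\<ge>M. \<forall>n\<ge>M. dist (Y m) (Y n) < e" by blast
  qed
  then obtain y where y: "Y \<longlonglongrightarrow> y"
    by (auto simp: Cauchy_convergent_iff convergent_def)
  have "dist (Y L) y \<le> real CARD('n) / 2 ^ L" for L
    by (rule LIMSEQ_le_const2[OF tendsto_dist[OF tendsto_const y]]) (use bound in blast)
  then show ?thesis using that y unfolding Y_def by blast
qed

lemma set_encode_less_power:
  assumes "A \<subseteq> {..<n}"
  shows "set_encode A < 2 ^ n"
proof -
  have "set_encode A \<le> (\<Sum>m<n. 2 ^ m)"
    unfolding set_encode_def using assms by (intro sum_mono2) auto
  also have "\<dots> < 2 ^ n"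
    by (induction n) auto
  finally show ?thesis .
qed

lemma mod_2_div_set_encode:
  "finite A \<Longrightarrow> set_encode A div 2 ^ m mod 2 = (if m \<in> A then 1 else 0)"
  using set_encode_inverse[of A] unfolding set_decode_def by (auto simp: mod2_eq_if)

text \<open>Since \<open>m < n\<close>, the quotient of \<open>radix n\<close> by
  \<open>2 ^ m\<close> is even, so the earlier digits do not disturb bit \<open>m\<close> of the
  last one.\<close>

lemma radix_div_power_mod_2:
  assumes "m < n"
  shows "(radix n * I + d) div 2 ^ m mod 2 = d div 2 ^ m mod 2"
proof -
  have "radix n = 2 ^ m * (2 * 2 ^ (n + 1 - m))"
    using assms by (simp add: radix_def power_add[symmetric] flip: power_Suc)
  then have "(radix n * I + d) div 2 ^ m = 2 * (2 ^ (n + 1 - m) * I) + d div 2 ^ m"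
    by (simp add: mult.assoc div_mult_self4 add.commute)
  then show ?thesis by simp
qed

lemma cell_vec_expansion:
  fixes y :: "real ^ 'n::enum"
  assumes origin: "\<And>i. guess_origin j $ i = of_int \<lfloor>y $ i\<rfloor>"
  obtains z where "z \<in> gap_set (radix CARD('n))" "nat \<lfloor>z\<rfloor> = j"
    "\<And>L. dist (cell_vec L (nat \<lfloor>real (radix CARD('n)) ^ L * z\<rfloor>)) y \<le> real CARD('n) / 2 ^ L"
proof -
  let ?n = "CARD('n)"
  \<comment> \<open>\<open>f i l\<close> is the first \<open>l\<close> binary digits of the
    fractional part of \<open>y $ i\<close>, read as an integer. The parity of
    \<open>f i (Suc l)\<close> is therefore the next bit, and \<open>D l\<close> collects the
    coordinates where that bit is 1.\<close>
  define f where "f i l = nat \<lfloor>real 2 ^ l * frac (y $ i)\<rfloor>" for i l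
  define D where "D l = enum_index ` {i :: 'n. odd (f i (Suc l))}" for l
  define I where "I = rec_nat j (\<lambda>l r. radix ?n * r + set_encode (D l))"
  have "inj (enum_index :: 'n \<Rightarrow> nat)"
    by (metis enum_index(2) injI)
  then have D: "enum_index i \<in> D l \<longleftrightarrow> odd (f i (Suc l))" for i l
    unfolding D_def by (auto dest: injD)
  have "D l \<subseteq> {..<?n}" for l
    unfolding D_def using enum_index(1) by auto
  from set_encode_less_power[OF this] have less: "set_encode (D l) < 2 ^ ?n" for l .
  have fin: "finite (D l)" for l unfolding D_def by simp
  have I: "I 0 = j" "I (Suc l) = radix ?n * I l + set_encode (D l)" for l
    unfolding I_def by simp_all
  obtain z where z: "z \<in> gap_set (radix ?n)" "\<And>l. nat \<lfloor>real (radix ?n) ^ l * z\<rfloor> = I l"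
  proof (rule gap_set_expansion[of "radix ?n" I "\<lambda>l. set_encode (D l)"])
    show "3 * set_encode (D l) + 1 \<le> radix ?n" for l
      using less[of l] by (simp add: radix_def)
  qed (use I(2) that in auto)
  have Idiv: "I (Suc l) div radix ?n = I l" for l
    using nat_floor_power_Suc_div[OF radix_pos] unfolding z(2)[symmetric] .
  have ds: "digit_sum ?n (enum_index i) L (I L) = f i L" for i :: 'n and L
  proof (induction L)
    case 0
    have "\<lfloor>frac (y $ i)\<rfloor> = 0"
      using frac_lt_1[of "y $ i"] frac_ge_0[of "y $ i"] by (intro floor_unique) auto
    then show ?case by (simp add: digit_sum_def f_def)
  next
    case (Suc L)
    have "f i (Suc L) div 2 = f i L"
      unfolding f_def by (rule nat_floor_power_Suc_div) simp
    moreover have "I (Suc L) div 2 ^ enum_index i mod 2 = f i (Suc L) mod 2"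
      unfolding I(2) radix_div_power_mod_2[OF enum_index(1)] mod_2_div_set_encode[OF fin] D
      by (simp add: odd_iff_mod_2_eq_one)
    ultimately show ?case
      unfolding digit_sum_Suc Idiv Suc by (metis add.commute div_mult_mod_eq mult.commute)
  qed
  have "\<bar>cell_vec L (I L) $ i - y $ i\<bar> \<le> 1 / 2 ^ L" for L i
  proof -
    have "0 \<le> 2 ^ L * frac (y $ i)" by simp
    then have "real (f i L) = of_int \<lfloor>2 ^ L * frac (y $ i)\<rfloor>"
      unfolding f_def by simp
    then have "real (f i L) \<le> 2 ^ L * frac (y $ i)" "2 ^ L * frac (y $ i) < real (f i L) + 1"
      by linarith+
    then have "real (f i L) / 2 ^ L \<le> frac (y $ i)" "frac (y $ i) \<le> (real (f i L) + 1) / 2 ^ L"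
      by (simp_all add: field_simps)
    then have "\<bar>real (f i L) / 2 ^ L - frac (y $ i)\<bar> \<le> 1 / 2 ^ L"
      by (simp add: add_divide_distrib)
    moreover have "cell_vec L (I L) $ i = of_int \<lfloor>y $ i\<rfloor> + real (f i L) / 2 ^ L"
      by (simp add: cell_vec_def ds expansion_div[of I, OF Idiv] I(1) origin)
    ultimately show ?thesis by (simp add: frac_def algebra_simps)
  qed
  from dist_le_of_components[OF this] have "dist (cell_vec L (I L)) y \<le> real ?n / 2 ^ L" for L
    by simp
  then show ?thesis
    using that[OF z(1)] z(2)[of 0] I(1) z(2) by simp
qed

section \<open>Approximate projection reduces to closed choice\<close>

definition removed_center :: "baire \<Rightarrow> nat \<Rightarrow> real ^ 'n::enum" where
  "removed_center p i = vec_code (fst (prod_decode (p (2 * i + 1))))"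

definition removed_radius :: "baire \<Rightarrow> nat \<Rightarrow> real" where
  "removed_radius p i = nnrat_code (snd (prod_decode (p (2 * i + 1))))"

text \<open>The three disjuncts witness, at precision \<open>L\<close>, that the coded point lies outside \<open>A\<close>, that
  its distance to \<open>x\<close> exceeds \<open>1 + e\<close> times the guessed radius, and that the guessed number of
  removed balls (slightly shrunk) fails to cover the open ball around \<open>x\<close> of the guessed radius.\<close>

definition refuted :: "'n::enum itself \<Rightarrow> real \<Rightarrow> baire \<Rightarrow> nat \<Rightarrow> nat \<Rightarrow> bool" where
  "refuted T e p L I \<longleftrightarrow>
     (\<exists>i<L. dist (cell_vec L I :: real ^ 'n::enum) (removed_center p i)
        < removed_radius p i - real CARD('n) / 2 ^ L) \<or>
     (1 + e) * guess_radius (I div radix CARD('n) ^ L) + real (CARD('n) + 1) / 2 ^ L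
        < dist (vec_code (p (2 * L)) :: real ^ 'n::enum) (cell_vec L I) \<or>
     guess_count (I div radix CARD('n) ^ L) \<le> L \<and>
     (\<exists>v<L. dist (vec_code (p (2 * L)) :: real ^ 'n::enum) (vec_code v)
          < guess_radius (I div radix CARD('n) ^ L) - 1 / 2 ^ L \<and>
        (\<forall>i<guess_count (I div radix CARD('n) ^ L).
           removed_radius p i - 1 / real (Suc (guess_count (I div radix CARD('n) ^ L)))
             < dist (vec_code v :: real ^ 'n::enum) (removed_center p i)))"

text \<open>Removed balls are inspected only for \<open>i < L\<close>; in the covering test this is
  ensured by the guard \<open>guess_count ... <= L\<close>. The name of \<open>x\<close> is read at
  position \<open>2 * L\<close>. This finite use is the locality needed by
  \<open>computable_pfI\<close>.\<close>

lemma refuted_cong: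
  fixes T :: "'n::enum itself"
  assumes "\<And>i. i \<le> 2 * L \<Longrightarrow> p i = p' i"
  shows "refuted T e p L I \<longleftrightarrow> refuted T e p' L I"
proof -
  have "removed_center p i = (removed_center p' i :: real ^ 'n::enum)" "removed_radius p i = removed_radius p' i"
    if "i < L" for i
    using that assms[of "2 * i + 1"] by (simp_all add: removed_center_def removed_radius_def)
  moreover have "p (2 * L) = p' (2 * L)" by (simp add: assms)
  ultimately show ?thesis
    unfolding refuted_def by (simp cong: conj_cong)
qed

text \<open>Every comparison is between a rational and a distance of rational vectors, and every
  quantifier has a computable bound. Rationality of \<open>e\<close> enters here.\<close>

lemma decidable_refuted:
  assumes "e \<in> \<rat>" "computable_nat u" "computable_nat f" "computable_nat g"
  shows "decidable (\<lambda>x. refuted TYPE('n::enum) e (code_nth (u x)) (f x) (g x))"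
proof -
  have *: "real (CARD('n) + 1) \<in> \<rat>" "real CARD('n) \<in> \<rat>" "1 + e \<in> \<rat>" "1 \<in> \<rat>"
    using assms(1) by auto
  have "decidable (\<lambda>t. refuted TYPE('n) e (code_nth (fst (prod_decode t)))
      (fst (prod_decode (snd (prod_decode t)))) (snd (prod_decode (snd (prod_decode t)))))"
    unfolding refuted_def removed_center_def removed_radius_def guess_radius_def guess_count_def
    by (intro computable_intros *)
  from decidable_comp[OF this, of "\<lambda>x. prod_encode (u x, prod_encode (f x, g x))"] show ?thesis
    using computable_prod_encode[OF assms(2) computable_prod_encode[OF assms(3,4)]] by simp
qed

lemma small_divide_power:
  fixes c \<delta> :: real
  assumes "\<delta> > 0"
  obtains L where "L \<ge> M" "c / 2 ^ L < \<delta>"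
proof -
  have "(\<lambda>L. c / 2 ^ L) \<longlonglongrightarrow> 0"
    using tendsto_mult_right_zero[OF LIMSEQ_power_zero[of "1/2 :: real"], of c]
    by (simp add: power_divide)
  then have "eventually (\<lambda>L. c / 2 ^ L < \<delta>) sequentially"
    using assms by (rule order_tendstoD(2))
  then obtain N where "\<And>L. L \<ge> N \<Longrightarrow> c / 2 ^ L < \<delta>"
    unfolding eventually_sequentially by blast
  then show ?thesis using that[of "max M N"] by simp
qed

lemma neg_rep_mem_iff:
  assumes "neg_rep (vec_code :: nat \<Rightarrow> real ^ 'n::enum) (\<lambda>i. p (2 * i + 1)) = Some A"
  shows "v \<in> A \<longleftrightarrow> (\<forall>i. removed_radius p i \<le> dist v (removed_center p i))"
proof -
  have "A = - (\<Union>i. ball (removed_center p i) (removed_radius p i))"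
    using assms unfolding neg_rep_def removed_center_def removed_radius_def by simp
  then show ?thesis by (auto simp: dist_commute not_less)
qed

text \<open>Failure of any conclusion leaves a positive margin. At a depth where twice the
  approximation error is below it, once for the approximation and once for the tolerance built into
  \<open>refuted\<close>, the matching disjunct holds.\<close>

lemma unrefuted_sound:
  fixes x y :: "real ^ 'n::enum" and A :: "(real ^ 'n::enum) set"
  assumes x: "cauchy_rep vec_code (\<lambda>i. p (2 * i)) = Some x"
    and A: "neg_rep vec_code (\<lambda>i. p (2 * i + 1)) = Some A"
    and I: "\<And>l. I (Suc l) div radix CARD('n) = I l"
    and nr: "\<And>l. \<not> refuted TYPE('n) e p l (I l)"
    and y: "\<And>L. dist (cell_vec L (I L)) y \<le> real CARD('n) / 2 ^ L"
  shows "y \<in> A" and "dist x y \<le> (1 + e) * guess_radius (I 0)"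
    and "\<And>a. a \<in> A \<Longrightarrow> guess_radius (I 0) \<le> dist x a"
proof -
  have I0: "I L div radix CARD('n) ^ L = I 0" for L
    by (rule expansion_div[of I, OF I])
  have xL: "dist (vec_code (p (2 * L))) x \<le> 1 / 2 ^ L" for L
    using cauchy_rep_SomeD(3)[OF x, of L] by (simp add: power_divide)
  show "y \<in> A"
    unfolding neg_rep_mem_iff[OF A]
  proof (rule allI, rule ccontr)
    fix i assume "\<not> removed_radius p i \<le> dist y (removed_center p i)"
    then have "removed_radius p i - dist y (removed_center p i) > 0" by simp
    then obtain L where L: "L \<ge> Suc i" "2 * real CARD('n) / 2 ^ L < removed_radius p i - dist y (removed_center p i)"
      by (rule small_divide_power)
    have "dist (cell_vec L (I L) :: real ^ 'n::enum) (removed_center p i) \<le> real CARD('n) / 2 ^ L + dist y (removed_center p i)"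
      using dist_triangle[of "cell_vec L (I L)" "removed_center p i" y] y[of L] by linarith
    then have "refuted TYPE('n) e p L (I L)"
      unfolding refuted_def using L by (intro disjI1 exI[of _ i]) simp
    then show False using nr by blast
  qed
  show "dist x y \<le> (1 + e) * guess_radius (I 0)"
  proof (rule ccontr)
    assume "\<not> ?thesis"
    then have "dist x y - (1 + e) * guess_radius (I 0) > 0" by simp
    then obtain L where L: "2 * (real CARD('n) + 1) / 2 ^ L < dist x y - (1 + e) * guess_radius (I 0)"
      by (rule small_divide_power[of _ 0])
    have "dist x y \<le> dist (vec_code (p (2 * L)) :: real ^ 'n::enum) (cell_vec L (I L)) + 1 / 2 ^ L + real CARD('n) / 2 ^ L"
      using dist_triangle[of x y "vec_code (p (2 * L))"] xL[of L] y[of L]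
        dist_triangle[of "vec_code (p (2 * L))" y "cell_vec L (I L)"]
      by (simp add: dist_commute)
    then have "refuted TYPE('n) e p L (I L)"
      unfolding refuted_def using L by (intro disjI2 disjI1) (simp add: I0 add_divide_distrib)
    then show False using nr by blast
  qed
  fix a assume a: "a \<in> A"
  show "guess_radius (I 0) \<le> dist x a"
  proof (rule ccontr)
    let ?s = "guess_radius (I 0)" and ?N = "guess_count (I 0)"
    assume "\<not> ?thesis"
    then have d: "?s - dist x a > 0" by simp
    \<comment> \<open>The point \<open>a\<close> is not rational in general. A rational
      \<open>v\<close> within half the margin is still inside the ball around \<open>x\<close>;
      within \<open>1 / Suc ?N\<close> of \<open>a\<close> it still avoids all the shrunk balls. The
      latter is the reason for shrinking.\<close>
    then obtain v where v: "dist (vec_code v) a < min ((?s - dist x a) / 2) (1 / real (Suc ?N))"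
      using vec_code_dense[of "min ((?s - dist x a) / 2) (1 / real (Suc ?N))" a] by auto
    from d have "(?s - dist x a) / 2 > 0" by simp
    then obtain L where L: "L \<ge> max (Suc v) ?N" "2 / 2 ^ L < (?s - dist x a) / 2"
      by (rule small_divide_power)
    have "dist (vec_code (p (2 * L)) :: real ^ 'n::enum) (vec_code v) < ?s - 1 / 2 ^ L"
      using dist_triangle[of "vec_code (p (2 * L))" "vec_code v" x] dist_triangle[of x "vec_code v" a]
        xL[of L] v L(2) by (simp add: dist_commute)
    moreover have "removed_radius p i - 1 / real (Suc ?N) < dist (vec_code v :: real ^ 'n::enum) (removed_center p i)" for i
    proof -
      have "removed_radius p i \<le> dist a (removed_center p i)"
        using a unfolding neg_rep_mem_iff[OF A] by blast
      then show ?thesis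
        using dist_triangle[of a "removed_center p i" "vec_code v"] v by (simp add: dist_commute)
    qed
    ultimately have "refuted TYPE('n) e p L (I L)"
      unfolding refuted_def I0 using L(1) by (intro disjI2 conjI exI[of _ v]) auto
    then show False using nr by blast
  qed
qed

text \<open>One number \<open>N\<close> bounds the indices of the balls and also sets the amount of
  shrinking: as it grows there are more balls and each shrinks less. Hence the open sets
  \<open>U N\<close> increase, and compactness of the closed ball leaves a single one.\<close>

lemma finite_shrunk_cover:
  fixes x :: "real ^ 'n::enum" and A :: "(real ^ 'n::enum) set"
  assumes A: "neg_rep vec_code (\<lambda>i. p (2 * i + 1)) = Some A" and "cball x s \<inter> A = {}"
  obtains N where "\<And>v. dist x v \<le> s \<Longrightarrow>
    \<exists>i<N. dist v (removed_center p i) \<le> removed_radius p i - 1 / real (Suc N)"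
proof -
  define U where "U N = (\<Union>i<N. ball (removed_center p i :: real ^ 'n::enum) (removed_radius p i - 1 / real (Suc N)))" for N
  have "cball x s \<subseteq> (\<Union>N\<in>UNIV. U N)"
  proof
    fix v assume "v \<in> cball x s"
    then have "v \<notin> A" using assms(2) by auto
    then obtain i where i: "dist v (removed_center p i) < removed_radius p i"
      unfolding neg_rep_mem_iff[OF A] by (auto simp: not_le)
    then obtain M where M: "inverse (real (Suc M)) < removed_radius p i - dist v (removed_center p i)"
      using reals_Archimedean[of "removed_radius p i - dist v (removed_center p i)"] by auto
    define N where "N = max (Suc i) M"
    have "1 / real (Suc N) \<le> inverse (real (Suc M))"
      unfolding N_def inverse_eq_divide by (intro divide_left_mono) auto
    with M have "v \<in> U N"
      unfolding U_def by (intro UN_I[of i]) (auto simp: N_def dist_commute)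
    then show "v \<in> (\<Union>N\<in>UNIV. U N)" by blast
  qed
  moreover have "open (U N)" for N
    unfolding U_def by auto
  ultimately obtain C where C: "finite C" "cball x s \<subseteq> (\<Union>N\<in>C. U N)"
    by (metis compact_cball compactE_image)
  define N where "N = Max (insert 0 C)"
  have "\<exists>i<N. dist v (removed_center p i) \<le> removed_radius p i - 1 / real (Suc N)" if "dist x v \<le> s" for v
  proof -
    have "v \<in> (\<Union>N\<in>C. U N)"
      using C(2) that by (auto simp: subset_iff)
    then obtain M i where M: "M \<in> C" "i < M" "dist v (removed_center p i) < removed_radius p i - 1 / real (Suc M)"
      unfolding U_def by (auto simp: dist_commute)
    have "M \<le> N" unfolding N_def using M(1) C(1) by simp
    then have "1 / real (Suc N) \<le> 1 / real (Suc M)"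
      by (intro divide_left_mono) auto
    then show ?thesis using M \<open>M \<le> N\<close> by (intro exI[of _ i]) auto
  qed
  then show ?thesis using that by blast
qed

text \<open>The tolerances in \<open>refuted\<close> are the worst-case errors,
  \<open>CARD('n) / 2 ^ L\<close> for the coded point and \<open>1 / 2 ^ L\<close> for
  \<open>x\<close>. By the triangle inequality a correct guess survives at every depth.\<close>

lemma unrefuted_complete:
  fixes x y :: "real ^ 'n::enum" and A :: "(real ^ 'n::enum) set"
  assumes x: "cauchy_rep vec_code (\<lambda>i. p (2 * i)) = Some x"
    and A: "neg_rep vec_code (\<lambda>i. p (2 * i + 1)) = Some A"
    and "y \<in> A" and xy: "dist x y \<le> (1 + e) * guess_radius j"
    and cover: "\<And>v. dist x v < guess_radius j \<Longrightarrow> \<exists>i<guess_count j.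
      dist v (removed_center p i) \<le> removed_radius p i - 1 / real (Suc (guess_count j))"
    and I0: "I div radix CARD('n) ^ L = j"
    and y: "dist (cell_vec L I) y \<le> real CARD('n) / 2 ^ L"
  shows "\<not> refuted TYPE('n) e p L I"
proof -
  have xL: "dist (vec_code (p (2 * L))) x \<le> 1 / 2 ^ L"
    using cauchy_rep_SomeD(3)[OF x, of L] by (simp add: power_divide)
  have "\<not> dist (cell_vec L I :: real ^ 'n::enum) (removed_center p i) < removed_radius p i - real CARD('n) / 2 ^ L" for i
  proof -
    have "removed_radius p i \<le> dist y (removed_center p i)"
      using \<open>y \<in> A\<close> unfolding neg_rep_mem_iff[OF A] by blast
    then show ?thesis
      using dist_triangle[of y "removed_center p i" "cell_vec L I"] y by (simp add: dist_commute)
  qed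
  moreover have "\<not> (1 + e) * guess_radius j + real (CARD('n) + 1) / 2 ^ L
      < dist (vec_code (p (2 * L)) :: real ^ 'n::enum) (cell_vec L I)"
    using dist_triangle[of "vec_code (p (2 * L))" "cell_vec L I" x] dist_triangle[of x "cell_vec L I" y]
      xL y xy by (simp add: dist_commute add_divide_distrib)
  moreover have "\<exists>i<guess_count j.
      \<not> removed_radius p i - 1 / real (Suc (guess_count j)) < dist (vec_code v :: real ^ 'n::enum) (removed_center p i)"
    if "dist (vec_code (p (2 * L))) (vec_code v :: real ^ 'n::enum) < guess_radius j - 1 / 2 ^ L" for v
  proof -
    have "dist x (vec_code v) < guess_radius j"
      using dist_triangle[of x "vec_code v" "vec_code (p (2 * L))"] xL that by (simp add: dist_commute)
    from cover[OF this] show ?thesis by (auto simp: not_less)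
  qed
  ultimately show ?thesis
    unfolding refuted_def I0 by blast
qed

section \<open>The closed set of unrefuted codes and its enumeration from outside\<close>

definition choice_set :: "'n::enum itself \<Rightarrow> real \<Rightarrow> baire \<Rightarrow> real set" where
  "choice_set T e p = {z \<in> gap_set (radix CARD('n)).
     \<forall>l. \<not> refuted T e p l (nat \<lfloor>real (radix CARD('n)) ^ l * z\<rfloor>)}"

lemma choice_set_nonempty:
  fixes x :: "real ^ 'n::enum" and A :: "(real ^ 'n::enum) set"
  assumes x: "cauchy_rep vec_code (\<lambda>i. p (2 * i)) = Some x"
    and A: "neg_rep vec_code (\<lambda>i. p (2 * i + 1)) = Some A" and "A \<noteq> {}" and "e > 0"
  shows "choice_set TYPE('n) e p \<noteq> {}"
proof -
  obtain y where y: "y \<in> A" "infdist x A = dist x y"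
    using infdist_attains_inf[OF neg_rep_closed[OF A] \<open>A \<noteq> {}\<close>] by blast
  obtain s N where s: "s \<in> \<rat>" "s \<ge> 0" "dist x y \<le> (1 + e) * s"
    and cover: "\<And>v. dist x v < s \<Longrightarrow>
      \<exists>i<N. dist v (removed_center p i) \<le> removed_radius p i - 1 / real (Suc N)"
  proof (cases "dist x y = 0")
    case True
    \<comment> \<open>No \<open>v\<close> satisfies \<open>dist x v < 0\<close>, so the covering
      condition is vacuous.\<close>
    show ?thesis by (rule that[of 0]) (use True in \<open>auto simp: not_less\<close>)
  next
    case False
    then have "dist x y / (1 + e) < dist x y"
      using \<open>e > 0\<close> by (simp add: divide_less_eq)
    \<comment> \<open>Strictness on the right makes even the closed ball miss \<open>A\<close>, as
      the compactness argument requires.\<close>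
    then obtain s where s: "s \<in> \<rat>" "dist x y / (1 + e) < s" "s < dist x y"
      using Rats_dense_in_real by blast
    have "a \<notin> cball x s" if "a \<in> A" for a
      using infdist_le[OF that, of x] y(2) s(3) by simp
    then have "cball x s \<inter> A = {}" by blast
    from finite_shrunk_cover[OF A this] obtain N where N: "\<And>v. dist x v \<le> s \<Longrightarrow>
      \<exists>i<N. dist v (removed_center p i) \<le> removed_radius p i - 1 / real (Suc N)" by blast
    show ?thesis
    proof (rule that[OF s(1) _ _ N])
      have "0 \<le> dist x y / (1 + e)" using \<open>e > 0\<close> by simp
      then show "s \<ge> 0" using s(2) by simp
      show "dist x y \<le> (1 + e) * s"
        using s(2) \<open>e > 0\<close> by (simp add: divide_less_eq mult.commute)
    qed simp
  qed
  obtain ks where ks: "nnrat_code ks = s" using nnrat_code_surj[OF s(1,2)] by blast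
  obtain kc where kc: "vec_code kc = ((\<chi> i. of_int \<lfloor>y $ i\<rfloor>) :: real ^ 'n::enum)"
    using vec_code_surj[of "\<chi> i. of_int \<lfloor>y $ i\<rfloor>"] by auto
  define j where "j = prod_encode (ks, prod_encode (N, kc))"
  have j: "guess_radius j = s" "guess_count j = N" "guess_origin j = ((\<chi> i. of_int \<lfloor>y $ i\<rfloor>) :: real ^ 'n::enum)"
    by (simp_all add: j_def guess_radius_def guess_count_def guess_origin_def ks kc)
  obtain z where z: "z \<in> gap_set (radix CARD('n))" "nat \<lfloor>z\<rfloor> = j"
    "\<And>L. dist (cell_vec L (nat \<lfloor>real (radix CARD('n)) ^ L * z\<rfloor>)) y \<le> real CARD('n) / 2 ^ L"
    using cell_vec_expansion[of j y] j(3) by auto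
  define I where "I l = nat \<lfloor>real (radix CARD('n)) ^ l * z\<rfloor>" for l
  have "I (Suc l) div radix CARD('n) = I l" for l
    unfolding I_def by (rule nat_floor_power_Suc_div) simp
  from expansion_div[of I, OF this] have I0: "I L div radix CARD('n) ^ L = j" for L
    using z(2) by (simp add: I_def)
  have "\<not> refuted TYPE('n) e p l (I l)" for l
    by (rule unrefuted_complete[OF x A y(1) _ _ I0]) (use s cover z(3) in \<open>auto simp: j I_def\<close>)
  then have "z \<in> choice_set TYPE('n) e p"
    unfolding choice_set_def using z(1) by (simp add: I_def)
  then show ?thesis by blast
qed

text \<open>Type 0 removes the gaps of the expansion, type 1 the negative numbers, and all other types
  remove the points of the gap set whose expansion to depth \<open>l\<close> is refuted.\<close>

definition interval_center :: "nat \<Rightarrow> nat \<Rightarrow> nat \<Rightarrow> nat \<Rightarrow> real" where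
  "interval_center b ty l I = (if ty = 0 then (real I + 2/3) / real b ^ l
     else if ty = 1 then - real (Suc I) else (real I + 1/6) / real b ^ l)"

definition interval_radius :: "nat \<Rightarrow> nat \<Rightarrow> nat \<Rightarrow> nat \<Rightarrow> real" where
  "interval_radius b ty l I = (if ty = 1 then real (Suc I) else (1/3) / real b ^ l)"

lemma mem_ball_scaled:
  fixes c r q z :: real
  assumes "q > 0"
  shows "z \<in> ball (c / q) (r / q) \<longleftrightarrow> \<bar>c - q * z\<bar> < r"
proof -
  have "c / q - z = (c - q * z) / q"
    using assms by (simp add: field_simps)
  then have "dist (c / q) z = \<bar>c - q * z\<bar> / q"
    using assms by (simp add: dist_real_def)
  then show ?thesis
    using assms by (simp add: divide_less_cancel)
qed

lemma mem_interval:
  assumes "b > 0"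
  shows "z \<in> ball (interval_center b 0 l I) (interval_radius b 0 l I)
      \<longleftrightarrow> \<bar>real I + 2/3 - real b ^ l * z\<bar> < 1/3"
    and "z \<in> ball (interval_center b 1 l I) (interval_radius b 1 l I)
      \<longleftrightarrow> \<bar>real (Suc I) + z\<bar> < real (Suc I)"
    and "ty \<ge> 2 \<Longrightarrow> z \<in> ball (interval_center b ty l I) (interval_radius b ty l I)
      \<longleftrightarrow> \<bar>real I + 1/6 - real b ^ l * z\<bar> < 1/3"
proof -
  have pos: "real b ^ l > 0" using assms by simp
  show "z \<in> ball (interval_center b 0 l I) (interval_radius b 0 l I)
      \<longleftrightarrow> \<bar>real I + 2/3 - real b ^ l * z\<bar> < 1/3"
    unfolding mem_ball_scaled[OF pos, symmetric] by (simp add: interval_center_def interval_radius_def)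
  show "z \<in> ball (interval_center b 1 l I) (interval_radius b 1 l I)
      \<longleftrightarrow> \<bar>real (Suc I) + z\<bar> < real (Suc I)"
    by (simp add: interval_center_def interval_radius_def dist_real_def abs_less_iff) linarith
  show "ty \<ge> 2 \<Longrightarrow> z \<in> ball (interval_center b ty l I) (interval_radius b ty l I)
      \<longleftrightarrow> \<bar>real I + 1/6 - real b ^ l * z\<bar> < 1/3"
    unfolding mem_ball_scaled[OF pos, symmetric] by (simp add: interval_center_def interval_radius_def)
qed

text \<open>In units of \<open>1 / b ^ l\<close>, type 0 removes the open interval from
  \<open>I + 1/3\<close> to \<open>I + 1\<close>. A refuted cell is removed by the one from
  \<open>I - 1/6\<close> to \<open>I + 1/2\<close>: it covers the whole closed cell from
  \<open>I\<close> to \<open>I + 1/3\<close>, and its overhang on both sides stays within gaps, so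
  no other point of \<open>gap_set\<close> is lost.\<close>

lemma choice_set_Compl:
  fixes T :: "'n::enum itself"
  defines "b \<equiv> radix CARD('n)"
  shows "- choice_set T e p = (\<Union>(ty, l, I)\<in>{(ty, l, I). ty < 2 \<or> refuted T e p l I}.
    ball (interval_center b ty l I) (interval_radius b ty l I))" (is "_ = ?R")
proof (intro equalityI subsetI)
  have "b > 0" by (simp add: b_def)
  note mem = mem_interval[OF this]
  fix z assume z: "z \<in> - choice_set T e p"
  consider (neg) "z < 0" | (gap) l where "0 \<le> z" "frac (real b ^ l * z) > 1/3"
    | (ref) l where "z \<in> gap_set b" "refuted T e p l (nat \<lfloor>real b ^ l * z\<rfloor>)"
  proof (cases "z \<in> gap_set b")
    case True
    then obtain l where "refuted T e p l (nat \<lfloor>real b ^ l * z\<rfloor>)"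
      using z unfolding choice_set_def b_def by blast
    then show ?thesis using True ref by blast
  next
    case False
    then have "z < 0 \<or> (\<exists>l. 0 \<le> z \<and> frac (real b ^ l * z) > 1/3)"
      unfolding gap_set_def mem_Collect_eq by (meson not_le)
    then show ?thesis using neg gap by blast
  qed
  then show "z \<in> ?R"
  proof cases
    case neg
    obtain I :: nat where "- z < real I" using reals_Archimedean2 by blast
    with neg have "z \<in> ball (interval_center b 1 0 I) (interval_radius b 1 0 I)"
      unfolding mem(2) by simp
    then show ?thesis by (intro UN_I[of "(1, 0, I)"]) auto
  next
    case gap
    define I where "I = nat \<lfloor>real b ^ l * z\<rfloor>"
    have "real I = of_int \<lfloor>real b ^ l * z\<rfloor>"
      using gap(1) by (simp add: I_def)
    then have "\<bar>real I + 2/3 - real b ^ l * z\<bar> < 1/3"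
      using gap(2) floor_correct[of "real b ^ l * z"] unfolding frac_def by linarith
    then have "z \<in> ball (interval_center b 0 l I) (interval_radius b 0 l I)"
      unfolding mem(1) .
    then show ?thesis by (intro UN_I[of "(0, l, I)"]) auto
  next
    case ref
    define I where "I = nat \<lfloor>real b ^ l * z\<rfloor>"
    have "0 \<le> z" "frac (real b ^ l * z) \<le> 1/3"
      using ref(1) unfolding gap_set_def by auto
    moreover from this have "real I = of_int \<lfloor>real b ^ l * z\<rfloor>"
      by (simp add: I_def)
    ultimately have "\<bar>real I + 1/6 - real b ^ l * z\<bar> < 1/3"
      using floor_correct[of "real b ^ l * z"] unfolding frac_def by linarith
    then have "z \<in> ball (interval_center b 2 l I) (interval_radius b 2 l I)"
      by (simp only: mem(3))
    then show ?thesis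
      using ref(2) by (intro UN_I[of "(2, l, I)"]) (auto simp: I_def)
  qed
next
  have "b > 0" by (simp add: b_def)
  note mem = mem_interval[OF this]
  fix z assume "z \<in> ?R"
  then obtain ty l I where ty: "ty < 2 \<or> refuted T e p l I"
    and z: "z \<in> ball (interval_center b ty l I) (interval_radius b ty l I)" by auto
  show "z \<in> - choice_set T e p"
  proof
    assume c: "z \<in> choice_set T e p"
    then have z0: "0 \<le> z" and fr: "frac (real b ^ l * z) \<le> 1/3"
      and nr: "\<not> refuted T e p l (nat \<lfloor>real b ^ l * z\<rfloor>)"
      unfolding choice_set_def gap_set_def b_def by auto
    consider "ty = 0" | "ty = 1" | "ty \<ge> 2" by linarith
    then show False
    proof cases
      case 1
      then have "\<bar>real I + 2/3 - real b ^ l * z\<bar> < 1/3"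
        using z mem(1) by blast
      moreover from this have "\<lfloor>real b ^ l * z\<rfloor> = int I"
        by (intro floor_unique; simp only: of_int_of_nat_eq abs_less_iff) linarith+
      ultimately show False using fr unfolding frac_def by (simp add: abs_less_iff)
    next
      case 2
      then show False
        using z z0 unfolding 2 mem(2) by simp
    next
      case 3
      then have z': "\<bar>real I + 1/6 - real b ^ l * z\<bar> < 1/3"
        using z mem(3) by blast
      \<comment> \<open>A value between \<open>I - 1/6\<close> and \<open>I\<close> would have
        fractional part above 5/6, contradicting \<open>fr\<close>.\<close>
      then have "\<lfloor>real b ^ l * z\<rfloor> = int I"
        using fr floor_correct[of "real b ^ l * z"] unfolding frac_def abs_less_iff by linarith
      then show False using nr ty 3 by simp
    qed
  qed
qed

lemma choice_set_computable:
  assumes "e \<in> \<rat>"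
  obtains K where "computable_pf (\<lambda>p. Some (K p))" "\<And>p. neg_rep rat_code (K p) = Some (choice_set TYPE('n::enum) e p)"
proof -
  define b where "b = radix CARD('n)"
  define ty l I where "ty k = fst (prod_decode k)" and "l k = fst (prod_decode (snd (prod_decode k)))"
    and "I k = snd (prod_decode (snd (prod_decode k)))" for k
  have tylI: "computable_nat ty" "computable_nat l" "computable_nat I"
    unfolding ty_def l_def I_def by (intro computable_intros)+
  have "b > 0" by (simp add: b_def)
  note div = computable_rat_divide_power[OF _ _ this]
  have rats: "2/3 \<in> (\<rat> :: real set)" "1/6 \<in> (\<rat> :: real set)" "1/3 \<in> (\<rat> :: real set)"
    by simp_all
  have "computable_rat (\<lambda>k. interval_center b (ty k) (l k) (I k))"
    unfolding interval_center_def by (intro div tylI rats computable_intros)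
  then obtain gc where gc: "computable_nat gc" "\<And>k. rat_code (gc k) = interval_center b (ty k) (l k) (I k)"
    by (elim computable_rat_codeE) blast
  have "computable_rat (\<lambda>k. interval_radius b (ty k) (l k) (I k))"
    unfolding interval_radius_def by (intro div tylI rats computable_intros)
  then obtain gr where gr: "computable_nat gr" "\<And>k. nnrat_code (gr k) = interval_radius b (ty k) (l k) (I k)"
    by (elim computable_nnrat_codeE) (auto simp: interval_radius_def)
  \<comment> \<open>The index runs through all triples. A triple with nothing to remove yields the
    output 0, which codes a ball of radius 0 and hence the empty set.\<close>
  define K :: "baire \<Rightarrow> baire" where
    "K p k = (if ty k < 2 \<or> refuted TYPE('n) e p (l k) (I k) then prod_encode (gc k, gr k) else 0)" for p k
  have "computable_pf (\<lambda>p. Some (K p))"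
  \<comment> \<open>The depth satisfies \<open>l k <= k\<close>, and \<open>refuted\<close> reads
    positions up to \<open>2 * l k\<close>.\<close>
  proof (rule computable_pfI[where c = 2])
    show "computable_nat (\<lambda>t. K (code_nth (fst (prod_decode t))) (snd (prod_decode t)))"
      unfolding K_def
      by (intro decidable_refuted assms computable_comp[OF gc(1)] computable_comp[OF gr(1)]
          computable_comp[OF tylI(1)] computable_comp[OF tylI(2)] computable_comp[OF tylI(3)] computable_intros)
    fix p p' :: baire and k
    assume eq: "\<And>i. i < 2 * Suc k \<Longrightarrow> p i = p' i"
    have "l k \<le> snd (prod_decode k)"
      using le_prod_encode_1[of "l k" "I k"] by (simp add: l_def I_def)
    also have "\<dots> \<le> k"
      using le_prod_encode_2[of "snd (prod_decode k)" "ty k"] by (simp add: ty_def)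
    finally have "refuted TYPE('n) e p (l k) (I k) \<longleftrightarrow> refuted TYPE('n) e p' (l k) (I k)"
      by (intro refuted_cong eq) simp
    then show "K p k = K p' k"
      unfolding K_def by simp
  qed simp
  moreover have "neg_rep rat_code (K p) = Some (choice_set TYPE('n) e p)" for p
  proof -
    have "nnrat_code 0 = 0" by (simp add: nnrat_code_def)
    let ?B = "\<lambda>k. ball (rat_code (fst (prod_decode (K p k)))) (nnrat_code (snd (prod_decode (K p k))))"
    have B: "?B k = (if ty k < 2 \<or> refuted TYPE('n) e p (l k) (I k)
        then ball (interval_center b (ty k) (l k) (I k)) (interval_radius b (ty k) (l k) (I k)) else {})" for k
      using \<open>nnrat_code 0 = 0\<close> by (simp add: K_def gc gr)
    have "(\<Union>k. ?B k) = - choice_set TYPE('n) e p"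
      unfolding choice_set_Compl b_def[symmetric]
    proof (intro equalityI subsetI)
      fix z assume "z \<in> (\<Union>k. ?B k)"
      then obtain k where "z \<in> ?B k" by blast
      then show "z \<in> (\<Union>(ty, l, I)\<in>{(ty, l, I). ty < 2 \<or> refuted TYPE('n) e p l I}.
          ball (interval_center b ty l I) (interval_radius b ty l I))"
        unfolding B by (intro UN_I[of "(ty k, l k, I k)"]) (auto split: if_splits)
    next
      fix z assume "z \<in> (\<Union>(ty, l, I)\<in>{(ty, l, I). ty < 2 \<or> refuted TYPE('n) e p l I}.
          ball (interval_center b ty l I) (interval_radius b ty l I))"
      then obtain t m J where t: "t < 2 \<or> refuted TYPE('n) e p m J"
        and z: "z \<in> ball (interval_center b t m J) (interval_radius b t m J)" by auto
      let ?k = "prod_encode (t, prod_encode (m, J))"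
      have "ty ?k = t" "l ?k = m" "I ?k = J" by (simp_all add: ty_def l_def I_def)
      then have "z \<in> ?B ?k" unfolding B using t z by simp
      then show "z \<in> (\<Union>k. ?B k)" by blast
    qed
    then show ?thesis unfolding neg_rep_def by simp
  qed
  ultimately show ?thesis using that by blast
qed

text \<open>At depth \<open>L = k + CARD('n)\<close> the cell is within \<open>2 ^ (- k)\<close> of
  the coded point. The scale there is \<open>radix CARD('n) ^ L = 2 ^ ((CARD('n) + 2) * L)\<close>,
  so the entry of the name at index \<open>(CARD('n) + 2) * L + 2\<close> has scaled error at most
  1/4, just what \<open>gap_set_floor_approx\<close> tolerates.\<close>

lemma cell_vec_of_name_computable:
  obtains H where "computable_pf (\<lambda>q. Some (H q))"
    "\<And>q k. vec_code (H q k) = (cell_vec (k + CARD('n)) (nat \<lfloor>real (radix CARD('n)) ^ (k + CARD('n))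
        * rat_code (q ((CARD('n) + 2) * (k + CARD('n)) + 2)) + 1/3\<rfloor>) :: real ^ 'n::enum)"
proof -
  let ?n = "CARD('n)"
  have "computable_vec (\<lambda>t. cell_vec (fst (prod_decode t)) (snd (prod_decode t)) :: real ^ 'n::enum)"
    by (intro computable_intros)
  then obtain g where g: "computable_nat g"
    "\<And>t. vec_code (g t) = (cell_vec (fst (prod_decode t)) (snd (prod_decode t)) :: real ^ 'n::enum)"
    by (elim computable_vec_codeE) blast
  define H :: "baire \<Rightarrow> baire" where
    "H q k = g (prod_encode (k + ?n, nat \<lfloor>real (radix ?n) ^ (k + ?n)
        * rat_code (q ((?n + 2) * (k + ?n) + 2)) + 1/3\<rfloor>))" for q k
  have "computable_pf (\<lambda>q. Some (H q))"
  proof (rule computable_pfI[where c = "(?n + 2) * (?n + 1) + 3"])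
    have "1/3 \<in> (\<rat> :: real set)" by simp
    then show "computable_nat (\<lambda>t. H (code_nth (fst (prod_decode t))) (snd (prod_decode t)))"
      unfolding H_def by (intro computable_comp[OF g(1)] computable_intros)
    fix p p' :: baire and k
    assume eq: "\<And>i. i < ((?n + 2) * (?n + 1) + 3) * Suc k \<Longrightarrow> p i = p' i"
    have "k + ?n \<le> (?n + 1) * Suc k" by simp
    then have "(?n + 2) * (k + ?n) \<le> (?n + 2) * ((?n + 1) * Suc k)"
      by (rule mult_le_mono2)
    then have "(?n + 2) * (k + ?n) + 2 < ((?n + 2) * (?n + 1) + 3) * Suc k"
      by (simp only: add_mult_distrib mult.assoc) simp
    then show "H p k = H p' k"
      unfolding H_def by (simp only: eq)
  qed simp
  moreover have "vec_code (H q k) = (cell_vec (k + ?n) (nat \<lfloor>real (radix ?n) ^ (k + ?n)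
        * rat_code (q ((?n + 2) * (k + ?n) + 2)) + 1/3\<rfloor>) :: real ^ 'n::enum)" for q k
    by (simp only: H_def g(2) prod_encode_inverse fst_conv snd_conv)
  ultimately show ?thesis using that by blast
qed

lemma eps_proj_le_closed_choice:
  assumes "\<epsilon> > 0"
  shows "sW_le (eps_proj \<epsilon>)
     (pair_rep (cauchy_rep (vec_code :: nat \<Rightarrow> real ^ 'n::enum)) (neg_rep (vec_code :: nat \<Rightarrow> real ^ 'n::enum)))
     (cauchy_rep (vec_code :: nat \<Rightarrow> real ^ 'n::enum))
     closed_choice (neg_rep rat_code) (cauchy_rep rat_code)"
proof -
  let ?n = "CARD('n)"
  \<comment> \<open>Only a rational \<open>e\<close> can enter a computable refutation test. A
    smaller factor gives a stronger bound, so it also serves for \<open>\<epsilon>\<close>.\<close>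
  obtain e where e: "e \<in> \<rat>" "0 < e" "e < \<epsilon>"
    using Rats_dense_in_real[OF assms] by blast
  obtain K where K: "computable_pf (\<lambda>p. Some (K p))"
    "\<And>p. neg_rep rat_code (K p) = Some (choice_set TYPE('n) e p)"
    using choice_set_computable[OF e(1)] by blast
  obtain H where H: "computable_pf (\<lambda>q. Some (H q))"
    "\<And>q k. vec_code (H q k) = (cell_vec (k + ?n) (nat \<lfloor>real (radix ?n) ^ (k + ?n)
        * rat_code (q ((?n + 2) * (k + ?n) + 2)) + 1/3\<rfloor>) :: real ^ 'n::enum)"
    using cell_vec_of_name_computable by blast
  have "\<exists>z. neg_rep rat_code (K p) = Some z \<and> closed_choice z \<noteq> {} \<and>
      (\<forall>q w. cauchy_rep rat_code q = Some w \<longrightarrow> w \<in> closed_choice z \<longrightarrow>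
        (\<exists>y. cauchy_rep vec_code (H q) = Some y \<and> y \<in> eps_proj \<epsilon> xA))"
    if p: "pair_rep (cauchy_rep vec_code) (neg_rep vec_code) p = Some xA" and ne: "eps_proj \<epsilon> xA \<noteq> {}"
    for p and xA :: "(real ^ 'n::enum) \<times> (real ^ 'n::enum) set"
  proof -
    obtain x A where xA: "xA = (x, A)" by fastforce
    have x: "cauchy_rep vec_code (\<lambda>i. p (2 * i)) = Some x"
      and A: "neg_rep vec_code (\<lambda>i. p (2 * i + 1)) = Some A"
      using p unfolding pair_rep_def xA by (auto split: option.splits)
    have "A \<noteq> {}" using ne unfolding xA eps_proj_def by auto
    have "\<exists>y. cauchy_rep vec_code (H q) = Some y \<and> y \<in> eps_proj \<epsilon> xA"
      if q: "cauchy_rep rat_code q = Some z" and z: "z \<in> choice_set TYPE('n) e p" for q z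
    proof -
      have gap: "z \<in> gap_set (radix ?n)" using z unfolding choice_set_def by blast
      define I where "I l = nat \<lfloor>real (radix ?n) ^ l * z\<rfloor>" for l
      have I: "I (Suc l) div radix ?n = I l" for l
        unfolding I_def by (rule nat_floor_power_Suc_div) simp
      obtain y :: "real ^ 'n::enum" where y: "\<And>L. dist (cell_vec L (I L)) y \<le> real ?n / 2 ^ L"
        and lim: "(\<lambda>L. cell_vec L (I L)) \<longlonglongrightarrow> y"
        using cell_vec_limit[of I, OF I] by blast
      have HI: "vec_code (H q k) = (cell_vec (k + ?n) (I (k + ?n)) :: real ^ 'n::enum)" for k
      proof -
        let ?l = "k + ?n"
        have "real (radix ?n) ^ ?l * (1/2) ^ ((?n + 2) * ?l + 2) = 1/4"
        proof -
          have "real (radix ?n) ^ ?l = 2 ^ ((?n + 2) * ?l)"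
            unfolding radix_def power_mult by simp
          then show ?thesis
            unfolding power_add[of _ "(?n + 2) * ?l"] by (simp add: power_divide)
        qed
        moreover have "\<bar>rat_code (q ((?n + 2) * ?l + 2)) - z\<bar> \<le> (1/2) ^ ((?n + 2) * ?l + 2)"
          using cauchy_rep_SomeD(3)[OF q] by (simp only: dist_real_def)
        ultimately have "real (radix ?n) ^ ?l * \<bar>rat_code (q ((?n + 2) * ?l + 2)) - z\<bar> \<le> 1/4"
          by (metis mult_left_mono of_nat_0_le_iff zero_le_power)
        from gap_set_floor_approx[OF gap this] show ?thesis
          unfolding H(2) I_def by simp
      qed
      have "cauchy_rep vec_code (H q) = Some y"
      proof (rule cauchy_rep_SomeI)
        fix i j :: nat assume "i \<le> j"
        then have "dist (vec_code (H q i) :: real ^ 'n::enum) (vec_code (H q j)) \<le> real ?n / 2 ^ (i + ?n)"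
          unfolding HI by (intro cell_vec_dist[of I, OF I]) simp
        \<comment> \<open>The shift of the depth by \<open>?n\<close> absorbs the factor
          \<open>?n\<close> of the coordinatewise estimate, since
          \<open>?n < 2 ^ ?n\<close>.\<close>
        also have "\<dots> \<le> 2 ^ ?n / 2 ^ (i + ?n)"
          using less_exp[of ?n] by (intro divide_right_mono) (auto simp: of_nat_less_numeral_power_cancel_iff less_imp_le)
        also have "\<dots> = (1/2) ^ i"
          by (simp add: power_add power_divide)
        finally show "dist (vec_code (H q i) :: real ^ 'n::enum) (vec_code (H q j)) \<le> (1/2) ^ i" .
      qed (use LIMSEQ_ignore_initial_segment[OF lim, of ?n] in \<open>simp only: HI\<close>)
      moreover have nr: "\<not> refuted TYPE('n) e p l (I l)" for l
        using z unfolding choice_set_def I_def by blast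
      note sound = unrefuted_sound[OF x A I nr y]
      have "guess_radius (I 0) \<le> infdist x A"
        using sound(3) \<open>A \<noteq> {}\<close> by (simp add: infdist_notempty cINF_greatest)
      then have "(1 + e) * guess_radius (I 0) \<le> (1 + \<epsilon>) * infdist x A"
        using e(2,3) by (intro mult_mono) (auto simp: infdist_nonneg guess_radius_def nnrat_code_def split_beta)
      then have "y \<in> eps_proj \<epsilon> xA"
        using sound(1,2) \<open>A \<noteq> {}\<close> unfolding xA eps_proj_def by simp
      ultimately show ?thesis by blast
    qed
    moreover have "choice_set TYPE('n) e p \<noteq> {}"
      by (rule choice_set_nonempty[OF x A \<open>A \<noteq> {}\<close> e(2)])
    ultimately show ?thesis
      using K(2) unfolding closed_choice_def by blast
  qed
  then show ?thesis
    by (rule sW_leI[OF H(1) K(1)])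
qed

theorem theorem5p3:
  fixes \<epsilon> :: real
  assumes "\<epsilon> > 0"
  shows "sW_equiv
     (eps_proj \<epsilon> :: (real ^ 'n::enum) \<times> (real ^ 'n::enum) set \<Rightarrow> (real ^ 'n::enum) set)
     (pair_rep (cauchy_rep (vec_code :: nat \<Rightarrow> real ^ 'n::enum)) (neg_rep (vec_code :: nat \<Rightarrow> real ^ 'n::enum)))
     (cauchy_rep (vec_code :: nat \<Rightarrow> real ^ 'n::enum))
     (closed_choice :: real set \<Rightarrow> real set) (neg_rep rat_code) (cauchy_rep rat_code)"
  unfolding sW_equiv_def
  using eps_proj_le_closed_choice[OF assms] closed_choice_le_eps_proj[OF less_imp_le[OF assms]] by blast

end
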